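(* There is a deterministic online algorithm for the online Rectilinear Steiner Arborescence problem that is $O\!\left(\frac{\log N}{\log\log N}\right)$-competitive, where $N$ is the number of input points; this competitive ratio is asymptotically optimal for deterministic online algorithms.
   Context: Rectilinear Steiner Arborescence (RSA): the input is a set of points $p_1=(x_1,y_1),\dots,p_N=(x_N,y_N)$ in the positive quadrant. A feasible solution is a set of horizontal and vertical line segments connecting every point to the origin $(0,0)$ such that, for each point, the path from the origin to it in the solution is both $x$-monotone and $y$-monotone (coordinates never decrease along it). The cost is the total length of the segments. Online RSA: the points arrive in nondecreasing order of $y$-coordinate; after receiving $p_i$ the algorithm must extend its current solution to connect $p_i$, subject to (1) segments once drawn are never deleted, and (2) segments added when handling $p_i$ may lie only in the region $y\ge y_{i-1}$. An online algorithm is $c$-competitive if its cost is at most $c$ times the optimal (offline) cost on every input. *)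

theory Defs
  imports "HOL-Analysis.Analysis" "HOL-Library.Landau_Symbols"
begin

type_synonym point = "real \<times> real"

text \<open>A segment is given by its two endpoints, the left or lower one first.\<close>

type_synonym segment = "point \<times> point"

definition axis_parallel :: "segment \<Rightarrow> bool" where
  "axis_parallel s \<longleftrightarrow>
     (snd (fst s) = snd (snd s) \<and> fst (fst s) \<le> fst (snd s)) \<or>
     (fst (fst s) = fst (snd s) \<and> snd (fst s) \<le> snd (snd s))"

definition seg_points :: "segment \<Rightarrow> point set" where
  "seg_points s = closed_segment (fst s) (snd s)"

definition cost :: "segment set \<Rightarrow> real" where
  "cost S = (\<Sum>s\<in>S. dist (fst s) (snd s))"

definition monotone_path :: "(real \<Rightarrow> point) \<Rightarrow> bool" where
  "monotone_path g \<longleftrightarrow>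
     path g \<and> mono_on {0..1} (\<lambda>t. fst (g t)) \<and> mono_on {0..1} (\<lambda>t. snd (g t))"

definition connects :: "segment set \<Rightarrow> point \<Rightarrow> bool" where
  "connects S p \<longleftrightarrow>
     (\<exists>g. monotone_path g \<and> pathstart g = (0, 0) \<and> pathfinish g = p \<and>
          path_image g \<subseteq> (\<Union>s\<in>S. seg_points s) \<union> {(0, 0)})"

text \<open>The singleton \<open>{(0, 0)}\<close> above only says that the root is present even if nothing
  has been drawn, so that an input point at the origin needs no segment.\<close>

definition feasible :: "segment set \<Rightarrow> point set \<Rightarrow> bool" where
  "feasible S P \<longleftrightarrow> finite S \<and> (\<forall>s\<in>S. axis_parallel s) \<and> (\<forall>p\<in>P. connects S p)"

definition opt :: "point set \<Rightarrow> real" where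
  "opt P = Inf {cost S | S. feasible S P}"

text \<open>An input lists the points in order of arrival; points with equal \<open>y\<close>-coordinate may
  arrive in any order.\<close>

definition rsa_input :: "point list \<Rightarrow> bool" where
  "rsa_input ps \<longleftrightarrow>
     distinct ps \<and> (\<forall>p\<in>set ps. 0 \<le> fst p \<and> 0 \<le> snd p) \<and> sorted (map snd ps)"

text \<open>A deterministic online algorithm maps the nonempty sequence \<open>p\<^sub>1, \<dots>, p\<^sub>i\<close> received so
  far to the set of segments added when handling \<open>p\<^sub>i\<close>. Drawn segments are never deleted
  because the current solution is the union of everything added so far.\<close>

type_synonym algorithm = "point list \<Rightarrow> segment set"

definition drawn :: "algorithm \<Rightarrow> point list \<Rightarrow> segment set" where
  "drawn A ps = (\<Union>i\<in>{1..length ps}. A (take i ps))"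

text \<open>The coordinate \<open>y\<^sub>i\<^sub>-\<^sub>1\<close> for \<open>ps = [p\<^sub>1, \<dots>, p\<^sub>i]\<close>, with the convention \<open>y\<^sub>0 = 0\<close>.\<close>

definition prev_y :: "point list \<Rightarrow> real" where
  "prev_y ps = (if length ps \<ge> 2 then snd (ps ! (length ps - 2)) else 0)"

definition online_algorithm :: "algorithm \<Rightarrow> bool" where
  "online_algorithm A \<longleftrightarrow>
     (\<forall>ps. rsa_input ps \<and> ps \<noteq> [] \<longrightarrow>
        (\<forall>s\<in>A ps. seg_points s \<subseteq> {z. prev_y ps \<le> snd z}) \<and>
        feasible (drawn A ps) (set ps))"

definition competitive_on :: "algorithm \<Rightarrow> nat \<Rightarrow> real \<Rightarrow> bool" where
  "competitive_on A N c \<longleftrightarrow>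
     (\<forall>ps. rsa_input ps \<and> length ps = N \<longrightarrow> cost (drawn A ps) \<le> c * opt (set ps))"

end

theory Submission
  imports Defs "HOL-Real_Asymp.Real_Asymp"
begin

text \<open>Read \<open>x\<close> as a location and \<open>y\<close> as time: vertical segments keep a copy at a location,
  horizontal ones deliver a copy to the right. Any solution spends at least \<open>min w h\<close> inside a
  \<open>w \<times> h\<close> rectangle whose upper right corner is a request, so disjoint rectangles bound the
  optimum from below.

  Upper bound. Split the line into cells of length \<open>d\<^sup>k\<close> for all integers \<open>k\<close>, and keep one copy
  in a cell for time \<open>d\<^sup>k\<close> after it was last touched. A request served from distance \<open>D\<close>
  touches the cells of all levels near it, and \<open>D / (d + 1)\<close> is the side of an empty square
  below and to the left of it. These squares are disjoint, so the deliveries cost \<open>O(d)\<close> times the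
  optimum; every level costs \<open>O(1)\<close> times the optimum for the copies kept. Requests cheaper than a
  fraction \<open>1 / H\<close> of the largest \<open>x\<close> change nothing, which leaves \<open>log\<^sub>d H\<close> levels for \<open>H\<close>
  requests. With \<open>H = d\<^sup>d\<close> this is \<open>O(d)\<close>, and doubling \<open>d\<close> whenever \<open>d\<^sup>d\<close> requests have
  arrived handles an unknown \<open>N\<close>.

  Lower bound. The adversary requests points moving right at unit speed. On every level \<open>k \<le> l\<close> it
  forces a copy at distance about \<open>d\<^sup>k\<close> to the left: if there is none, it returns to a point
  passed at most \<open>d\<^sup>k\<close> time units ago, where an offline solution could have kept a copy for
  \<open>d\<^sup>k\<close>, whereas the algorithm pays \<open>\<Omega>(d\<^sup>k\<^sup>+\<^sup>1)\<close>. With \<open>d = 8 l + 8\<close> either way the ratio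
  is \<open>\<Omega>(l)\<close>, using \<open>O(d\<^sup>l)\<close> requests.\<close>

section \<open>Length inside a rectangle\<close>

definition region :: "segment set \<Rightarrow> point set" where
  "region F = (\<Union>s\<in>F. seg_points s)"

lemma region_mono: "F \<subseteq> G \<Longrightarrow> region F \<subseteq> region G"
  by (auto simp: region_def)

lemma seg_points_horizontal:
  assumes "snd (fst s) = snd (snd s)" "fst (fst s) \<le> fst (snd s)"
  shows "seg_points s = {fst (fst s)..fst (snd s)} \<times> {snd (fst s)}"
proof -
  obtain a b c where s: "s = ((a, b), (c, b))" using assms(1) by (metis prod.collapse)
  then have "a \<le> c" using assms(2) by simp
  moreover have "z \<in> closed_segment (a, b) (c, b) \<longleftrightarrow> fst z \<in> closed_segment a c \<and> snd z = b" for z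
    by (cases z) (auto simp: closed_segment_def algebra_simps)
  ultimately show ?thesis
    by (auto simp: s seg_points_def closed_segment_eq_real_ivl)
qed

lemma seg_points_vertical:
  assumes "fst (fst s) = fst (snd s)" "snd (fst s) \<le> snd (snd s)"
  shows "seg_points s = {fst (fst s)} \<times> {snd (fst s)..snd (snd s)}"
proof -
  obtain a b c where s: "s = ((a, b), (a, c))" using assms(1) by (metis prod.collapse)
  then have "b \<le> c" using assms(2) by simp
  moreover have "z \<in> closed_segment (a, b) (a, c) \<longleftrightarrow> snd z \<in> closed_segment b c \<and> fst z = a" for z
    by (cases z) (auto simp: closed_segment_def algebra_simps)
  ultimately show ?thesis
    by (auto simp: s seg_points_def closed_segment_eq_real_ivl)
qed

lemma dist_horizontal:
  fixes s :: segment
  assumes "snd (fst s) = snd (snd s)" "fst (fst s) \<le> fst (snd s)"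
  shows "dist (fst s) (snd s) = fst (snd s) - fst (fst s)"
  using assms by (simp add: dist_prod_def dist_real_def)

lemma dist_vertical:
  fixes s :: segment
  assumes "fst (fst s) = fst (snd s)" "snd (fst s) \<le> snd (snd s)"
  shows "dist (fst s) (snd s) = snd (snd s) - snd (fst s)"
  using assms by (simp add: dist_prod_def dist_real_def)

lemma cost_nonneg: "0 \<le> cost S"
  by (simp add: cost_def sum_nonneg)

lemma cost_mono: "finite T \<Longrightarrow> S \<subseteq> T \<Longrightarrow> cost S \<le> cost T"
  unfolding cost_def by (intro sum_mono2) auto

lemma cost_Un: "finite S \<Longrightarrow> finite T \<Longrightarrow> cost (S \<union> T) \<le> cost S + cost T"
  unfolding cost_def by (simp add: sum_Un sum_nonneg)

lemma cost_insert: "finite S \<Longrightarrow> cost (insert s S) \<le> cost S + dist (fst s) (snd s)"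
  unfolding cost_def by (cases "s \<in> S") (auto simp: insert_absorb)

lemma connects_mono: "connects S p \<Longrightarrow> S \<subseteq> T \<Longrightarrow> connects T p"
  unfolding connects_def region_def[symmetric] using region_mono[of S T] by blast

lemma monotone_path_join:
  assumes "monotone_path g" "monotone_path h" "pathfinish g = pathstart h"
  shows "monotone_path (g +++ h)"
proof -
  have *: "mono_on {0..1} (\<lambda>t. f ((g +++ h) t))"
    if g: "mono_on {0..1} (\<lambda>t. f (g t))" and h: "mono_on {0..1} (\<lambda>t. f (h t))"
    for f :: "point \<Rightarrow> real"
  proof (rule mono_onI)
    fix s t :: real assume st: "s \<in> {0..1}" "t \<in> {0..1}" "s \<le> t"
    have eq: "f (g 1) = f (h 0)" using assms(3) by (simp add: pathfinish_def pathstart_def)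
    consider "t \<le> 1/2" | "s > 1/2" | "s \<le> 1/2" "t > 1/2" by linarith
    then show "f ((g +++ h) s) \<le> f ((g +++ h) t)"
    proof cases
      case 1
      then show ?thesis using st mono_onD[OF g, of "2 * s" "2 * t"] by (simp add: joinpaths_def)
    next
      case 2
      then show ?thesis using st mono_onD[OF h, of "2 * s - 1" "2 * t - 1"] by (simp add: joinpaths_def)
    next
      case 3
      then have "f (g (2 * s)) \<le> f (g 1)" "f (h 0) \<le> f (h (2 * t - 1))"
        using st mono_onD[OF g, of "2 * s" 1] mono_onD[OF h, of 0 "2 * t - 1"] by auto
      then show ?thesis using 3 eq by (simp add: joinpaths_def)
    qed
  qed
  show ?thesis using assms * unfolding monotone_path_def by auto
qed

lemma monotone_path_linepath:
  assumes "fst p \<le> fst q" "snd p \<le> snd q"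
  shows "monotone_path (linepath p q)"
proof -
  have "(1 - s) * a + s * b \<le> (1 - t) * a + t * b" if "a \<le> b" "s \<le> t" for a b s t :: real
  proof -
    have "0 \<le> (t - s) * (b - a)" using that by simp
    then show ?thesis by (simp add: algebra_simps)
  qed
  then have "mono_on {0..1} (\<lambda>t. fst (linepath p q t))" "mono_on {0..1} (\<lambda>t. snd (linepath p q t))"
    using assms by (auto simp: linepath_def intro!: mono_onI)
  then show ?thesis by (simp add: monotone_path_def)
qed

lemma connects_extend:
  assumes "connects S p" "S \<subseteq> T" "fst p \<le> fst q" "snd p \<le> snd q"
    "closed_segment p q \<subseteq> region T"
  shows "connects T q"
proof -
  obtain g where g: "monotone_path g" "pathstart g = (0, 0)" "pathfinish g = p"
    "path_image g \<subseteq> region S \<union> {(0, 0)}"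
    using assms(1) unfolding connects_def region_def by blast
  have "monotone_path (g +++ linepath p q)"
    using g assms by (intro monotone_path_join monotone_path_linepath) auto
  moreover have "path_image (g +++ linepath p q) \<subseteq> region T \<union> {(0, 0)}"
    using g(3,4) assms(5) region_mono[OF assms(2)] by (subst path_image_join) auto
  ultimately show ?thesis using g(2)
    unfolding connects_def region_def[symmetric] by (intro exI[of _ "g +++ linepath p q"]) auto
qed

lemma connects_origin: "connects S (0, 0)"
  unfolding connects_def
  by (intro exI[of _ "linepath (0,0) (0,0)"]) (auto intro!: monotone_path_linepath)

lemma connects_up:
  assumes "connects S (x, s)" "S \<subseteq> T" "((x, u), (x, v)) \<in> T" "u \<le> s" "s \<le> t" "t \<le> v"
  shows "connects T (x, t)"
proof (rule connects_extend[OF assms(1,2)])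
  have "closed_segment (x, s) (x, t) = {x} \<times> {s..t}"
    using seg_points_vertical[of "((x, s), (x, t))"] assms by (simp add: seg_points_def)
  also have "\<dots> \<subseteq> seg_points ((x, u), (x, v))"
    using assms by (subst seg_points_vertical) auto
  finally show "closed_segment (x, s) (x, t) \<subseteq> region T"
    using assms(3) unfolding region_def by blast
qed (use assms in auto)

lemma connects_right:
  assumes "connects S (x, t)" "S \<subseteq> T" "((a, t), (b, t)) \<in> T" "a \<le> x" "x \<le> z" "z \<le> b"
  shows "connects T (z, t)"
proof (rule connects_extend[OF assms(1,2)])
  have "closed_segment (x, t) (z, t) = {x..z} \<times> {t}"
    using seg_points_horizontal[of "((x, t), (z, t))"] assms by (simp add: seg_points_def)
  also have "\<dots> \<subseteq> seg_points ((a, t), (b, t))"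
    using assms by (subst seg_points_horizontal) auto
  finally show "closed_segment (x, t) (z, t) \<subseteq> region T"
    using assms(3) unfolding region_def by blast
qed (use assms in auto)

text \<open>The intermediate value theorem on each coordinate. Taking the parameter \<open>r\<close>
  after \<open>s\<close> allows a crossing to be located beyond a known point of the path.\<close>

lemma connects_path:
  assumes "connects S p"
  shows "\<exists>g. monotone_path g \<and> g 0 = (0, 0) \<and> g 1 = p \<and>
    (\<forall>s\<in>{0..1}. g s \<in> region S \<union> {(0, 0)}) \<and>
    (\<forall>s\<in>{0..1}. \<forall>z. fst (g s) \<le> z \<and> z \<le> fst p \<longrightarrow> (\<exists>r\<in>{s..1}. fst (g r) = z)) \<and>
    (\<forall>s\<in>{0..1}. \<forall>z. snd (g s) \<le> z \<and> z \<le> snd p \<longrightarrow> (\<exists>r\<in>{s..1}. snd (g r) = z))"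
proof -
  obtain g where g: "monotone_path g" "pathstart g = (0, 0)" "pathfinish g = p"
    "path_image g \<subseteq> region S \<union> {(0, 0)}"
    using assms unfolding connects_def region_def by blast
  have cont: "continuous_on {0..1} g" using g(1) by (simp add: monotone_path_def path_def)
  have ivt: "\<exists>r\<in>{s..1}. f (g r) = z"
    if "s \<in> {0..1}" "f (g s) \<le> z" "z \<le> f p" "continuous_on UNIV f" for f :: "point \<Rightarrow> real" and s z
  proof -
    have "continuous_on {s..1} (\<lambda>r. f (g r))"
      using that(1)
      by (intro continuous_on_compose2[OF that(4) continuous_on_subset[OF cont]]) auto
    then show ?thesis
      using IVT'[of "\<lambda>r. f (g r)" s z 1] that g(3) by (auto simp: pathfinish_def)
  qed
  have "g s \<in> region S \<union> {(0, 0)}" if "s \<in> {0..1}" for s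
    using g(4) that unfolding path_image_def by blast
  moreover have "\<exists>r\<in>{s..1}. fst (g r) = z" if "s \<in> {0..1}" "fst (g s) \<le> z" "z \<le> fst p" for s z
    using that by (intro ivt) (auto intro: continuous_intros)
  moreover have "\<exists>r\<in>{s..1}. snd (g r) = z" if "s \<in> {0..1}" "snd (g s) \<le> z" "z \<le> snd p" for s z
    using that by (intro ivt) (auto intro: continuous_intros)
  ultimately show ?thesis
    using g(1,2,3) unfolding pathstart_def pathfinish_def
    by (intro exI[of _ g] conjI ballI allI impI) (simp_all only: conj_absorb)
qed

lemma monotone_pathD:
  assumes "monotone_path g" "0 \<le> s" "s \<le> t" "t \<le> 1"
  shows "fst (g s) \<le> fst (g t)" "snd (g s) \<le> snd (g t)"
  using assms mono_onD[of "{0..1}" "\<lambda>t. fst (g t)" s t] mono_onD[of "{0..1}" "\<lambda>t. snd (g t)" s t]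
  unfolding monotone_path_def by auto

text \<open>If a column \<open>z\<close> and a row \<open>v\<close> of the rectangle were both
  missed, the path would meet the column at height at most \<open>t - h\<close> and the row at
  abscissa at most \<open>x - w\<close>. Whichever comes first on the path, monotonicity contradicts
  the other.\<close>

lemma connects_crosses_rectangle:
  assumes "connects S (x, t)" "w \<le> x"
  shows "(\<forall>z\<in>{x - w<..x}. \<exists>v\<in>{t - h<..t}. (z, v) \<in> region S) \<or>
         (\<forall>v\<in>{t - h<..t}. \<exists>z\<in>{x - w<..x}. (z, v) \<in> region S)"
proof (rule ccontr)
  assume "\<not> ?thesis"
  then obtain z v where z: "z \<in> {x - w<..x}" "\<And>v. v \<in> {t - h<..t} \<Longrightarrow> (z, v) \<notin> region S"
    and v: "v \<in> {t - h<..t}" "\<And>z. z \<in> {x - w<..x} \<Longrightarrow> (z, v) \<notin> region S" by blast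
  obtain g where "monotone_path g \<and> g 0 = (0, 0) \<and> g 1 = (x, t) \<and>
    (\<forall>s\<in>{0..1}. g s \<in> region S \<union> {(0, 0)}) \<and>
    (\<forall>s\<in>{0..1}. \<forall>z. fst (g s) \<le> z \<and> z \<le> fst (x, t) \<longrightarrow> (\<exists>r\<in>{s..1}. fst (g r) = z)) \<and>
    (\<forall>s\<in>{0..1}. \<forall>z. snd (g s) \<le> z \<and> z \<le> snd (x, t) \<longrightarrow> (\<exists>r\<in>{s..1}. snd (g r) = z))"
    using connects_path[OF assms(1)] ..
  note g = conjunct1[OF this] this[THEN conjunct2, THEN conjunct1]
    this[THEN conjunct2, THEN conjunct2, THEN conjunct1]
    this[THEN conjunct2, THEN conjunct2, THEN conjunct2, THEN conjunct1, rule_format]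
    this[THEN conjunct2, THEN conjunct2, THEN conjunct2, THEN conjunct2, THEN conjunct1, rule_format]
    this[THEN conjunct2, THEN conjunct2, THEN conjunct2, THEN conjunct2, THEN conjunct2, rule_format]
  have zpos: "0 < z" using z(1) assms(2) by simp
  obtain a where a: "a \<in> {0..1}" "fst (g a) = z" using g(5)[of 0 z] z(1) zpos g(2) by auto
  have ag: "(z, snd (g a)) \<in> region S"
    using g(4)[OF a(1)] a(2) zpos by (metis UnE fst_conv less_irrefl prod.collapse singletonD)
  have "snd (g a) \<le> t" using monotone_pathD(2)[OF g(1), of a 1] a g(3) by simp
  then have a3: "snd (g a) \<le> t - h" using z(2)[of "snd (g a)"] ag by fastforce
  \<comment> \<open>A priori \<open>h\<close> may exceed \<open>t\<close>; the crossing at height at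
    most \<open>t - h\<close> excludes this and makes \<open>v\<close> positive, so the path does
    climb to row \<open>v\<close>.\<close>
  have "0 \<le> snd (g a)" using monotone_pathD(2)[OF g(1), of 0 a] a g(2) by simp
  then have vpos: "0 < v" using a3 v(1) by simp
  obtain b where b: "b \<in> {0..1}" "snd (g b) = v" using g(6)[of 0 v] v(1) vpos g(2) by auto
  have bg: "(fst (g b), v) \<in> region S"
    using g(4)[OF b(1)] b(2) vpos by (metis UnE snd_conv less_irrefl prod.collapse singletonD)
  have "fst (g b) \<le> x" using monotone_pathD(1)[OF g(1), of b 1] b g(3) by simp
  then have b3: "fst (g b) \<le> x - w" using v(2)[of "fst (g b)"] bg by fastforce
  show False
  proof (cases "a \<le> b")
    case True
    then have "z \<le> fst (g b)" using monotone_pathD(1)[OF g(1), of a b] a b by simp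
    then show False using b3 z(1) by simp
  next
    case False
    then have "v \<le> snd (g a)" using monotone_pathD(2)[OF g(1), of b a] a b by simp
    then show False using a3 v(1) by simp
  qed
qed

section \<open>Length of a solution inside a Borel set\<close>

definition hset :: "segment \<Rightarrow> point set \<Rightarrow> real set" where
  "hset s B = {z. (z, snd (fst s)) \<in> seg_points s \<inter> B}"

definition vset :: "segment \<Rightarrow> point set \<Rightarrow> real set" where
  "vset s B = {v. (fst (fst s), v) \<in> seg_points s \<inter> B}"

text \<open>For an axis-parallel segment one of the two sets has at most one point and the other is
  a projection of the part inside \<open>B\<close>, so the sum is the length there whatever the
  direction. Overlapping segments count repeatedly, as in \<open>cost\<close>.\<close>

definition len :: "segment set \<Rightarrow> point set \<Rightarrow> real" where
  "len F B = (\<Sum>s\<in>F. measure lborel (hset s B) + measure lborel (vset s B))"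

lemma hset_subset: "hset s B \<subseteq> fst ` seg_points s"
  and vset_subset: "vset s B \<subseteq> snd ` seg_points s"
  by (force simp: hset_def vset_def)+

lemma seg_points_borel: "seg_points s \<in> sets borel"
  by (auto simp: seg_points_def intro!: borel_closed closed_segment)

lemma hset_borel:
  assumes "B \<in> sets borel" shows "hset s B \<in> sets borel"
proof -
  have "continuous_on UNIV (\<lambda>z::real. (z, snd (fst s)))" by (intro continuous_intros)
  then have "(\<lambda>z::real. (z, snd (fst s))) -` (seg_points s \<inter> B) \<in> sets borel"
    using assms seg_points_borel[of s]
    by (intro measurable_sets_borel[OF borel_measurable_continuous_onI]) auto
  then show ?thesis by (simp add: hset_def vimage_def)
qed

lemma vset_borel:
  assumes "B \<in> sets borel" shows "vset s B \<in> sets borel"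
proof -
  have "continuous_on UNIV (\<lambda>z::real. (fst (fst s), z))" by (intro continuous_intros)
  then have "(\<lambda>z::real. (fst (fst s), z)) -` (seg_points s \<inter> B) \<in> sets borel"
    using assms seg_points_borel[of s]
    by (intro measurable_sets_borel[OF borel_measurable_continuous_onI]) auto
  then show ?thesis by (simp add: vset_def vimage_def)
qed

lemma compact_seg_points: "compact (seg_points s)"
  by (simp add: seg_points_def)

lemma hset_fmeasurable: "B \<in> sets borel \<Longrightarrow> hset s B \<in> fmeasurable lborel"
proof (rule fmeasurableI)
  have "bounded (hset s B)"
    by (rule bounded_subset[OF _ hset_subset])
       (intro compact_imp_bounded compact_continuous_image continuous_intros compact_seg_points)
  then show "emeasure lborel (hset s B) < \<infinity>" by (rule emeasure_bounded_finite)
qed (simp add: hset_borel)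

lemma vset_fmeasurable: "B \<in> sets borel \<Longrightarrow> vset s B \<in> fmeasurable lborel"
proof (rule fmeasurableI)
  have "bounded (vset s B)"
    by (rule bounded_subset[OF _ vset_subset])
       (intro compact_imp_bounded compact_continuous_image continuous_intros compact_seg_points)
  then show "emeasure lborel (vset s B) < \<infinity>" by (rule emeasure_bounded_finite)
qed (simp add: vset_borel)

lemma measure_sum_le_disjoint:
  assumes "finite I" "disjoint_family_on A I" "\<And>i. i \<in> I \<Longrightarrow> A i \<in> fmeasurable M"
    "\<And>i. i \<in> I \<Longrightarrow> A i \<subseteq> C" "C \<in> fmeasurable M"
  shows "(\<Sum>i\<in>I. measure M (A i)) \<le> measure M C"
proof -
  have "measure M (\<Union>i\<in>I. A i) = (\<Sum>i\<in>I. measure M (A i))"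
    using assms by (intro measure_finite_Union) (auto dest: fmeasurableD2 fmeasurableD)
  moreover have "measure M (\<Union>i\<in>I. A i) \<le> measure M C"
    using assms by (intro measure_mono_fmeasurable) auto
  ultimately show ?thesis by simp
qed

lemma len_nonneg: "0 \<le> len F B"
  by (simp add: len_def sum_nonneg)

lemma len_mono: "finite G \<Longrightarrow> F \<subseteq> G \<Longrightarrow> len F B \<le> len G B"
  unfolding len_def by (intro sum_mono2) auto

lemma len_superadditive:
  assumes "finite I" "disjoint_family_on B I" "\<And>i. i \<in> I \<Longrightarrow> B i \<in> sets borel"
    "\<And>i. i \<in> I \<Longrightarrow> B i \<subseteq> C" "C \<in> sets borel"
  shows "(\<Sum>i\<in>I. len F (B i)) \<le> len F C"
proof -
  have "(\<Sum>i\<in>I. len F (B i)) =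
      (\<Sum>s\<in>F. (\<Sum>i\<in>I. measure lborel (hset s (B i))) + (\<Sum>i\<in>I. measure lborel (vset s (B i))))"
    unfolding len_def sum.distrib[symmetric] by (rule sum.swap)
  also have "\<dots> \<le> len F C"
    unfolding len_def
  proof (intro sum_mono add_mono measure_sum_le_disjoint)
    fix s
    show "disjoint_family_on (\<lambda>i. hset s (B i)) I" "disjoint_family_on (\<lambda>i. vset s (B i)) I"
      using assms(2) unfolding disjoint_family_on_def hset_def vset_def by blast+
    show "hset s (B i) \<subseteq> hset s C" "vset s (B i) \<subseteq> vset s C" if "i \<in> I" for i
      using assms(4)[OF that] unfolding hset_def vset_def by blast+
  qed (use assms in \<open>auto intro: hset_fmeasurable vset_fmeasurable\<close>)
  finally show ?thesis .
qed

lemma len_subset: "B \<subseteq> C \<Longrightarrow> B \<in> sets borel \<Longrightarrow> C \<in> sets borel \<Longrightarrow> len F B \<le> len F C"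
  using len_superadditive[of "{()}" "\<lambda>_. B" C F] by (simp add: disjoint_family_on_def)

lemma len_UNIV_le_cost:
  assumes "\<forall>s\<in>F. axis_parallel s"
  shows "len F UNIV \<le> cost F"
  unfolding len_def cost_def
proof (rule sum_mono)
  fix s assume "s \<in> F"
  then consider "snd (fst s) = snd (snd s)" "fst (fst s) \<le> fst (snd s)"
    | "fst (fst s) = fst (snd s)" "snd (fst s) \<le> snd (snd s)"
    using assms unfolding axis_parallel_def by blast
  then show "measure lborel (hset s UNIV) + measure lborel (vset s UNIV) \<le> dist (fst s) (snd s)"
  proof cases
    case 1
    have "hset s UNIV = {fst (fst s)..fst (snd s)}" "vset s UNIV = {snd (fst s)}"
      using 1 by (auto simp: hset_def vset_def seg_points_horizontal)
    then show ?thesis using 1 by (simp add: dist_horizontal)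
  next
    case 2
    have "vset s UNIV = {snd (fst s)..snd (snd s)}" "hset s UNIV = {fst (fst s)}"
      using 2 by (auto simp: hset_def vset_def seg_points_vertical)
    then show ?thesis using 2 by (simp add: dist_vertical)
  qed
qed

lemma measure_cover_le:
  fixes a b :: real
  assumes "finite F" "finite Z" "\<And>s. s \<in> F \<Longrightarrow> A s \<in> fmeasurable lborel"
    "{a<..<b} \<subseteq> (\<Union>s\<in>F. A s) \<union> Z"
  shows "b - a \<le> (\<Sum>s\<in>F. measure lborel (A s))"
proof (cases "a \<le> b")
  case True
  have Z: "Z \<in> fmeasurable lborel" "measure lborel Z = 0"
    using assms(2) finite_imp_null_set_lborel[OF assms(2)]
    by (auto intro: measure_eq_0_null_sets fmeasurableI_null_sets)
  have U: "(\<Union>s\<in>F. A s) \<in> fmeasurable lborel" using assms(1,3) by (rule fmeasurable.finite_UN)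
  have "b - a = measure lborel {a<..<b}" using True by simp
  also have "\<dots> \<le> measure lborel ((\<Union>s\<in>F. A s) \<union> Z)"
    using U Z assms(4) by (intro measure_mono_fmeasurable) auto
  also have "\<dots> \<le> measure lborel (\<Union>s\<in>F. A s) + measure lborel Z"
    using U Z by (intro measure_Un_le) auto
  also have "\<dots> \<le> (\<Sum>s\<in>F. measure lborel (A s))"
    using measure_UNION_le[OF assms(1), of A lborel] fmeasurableD[OF assms(3)] Z by auto
  finally show ?thesis .
next
  case False
  then show ?thesis using sum_nonneg[of F "\<lambda>s. measure lborel (A s)"] by simp
qed

text \<open>Vertical segments occupy finitely many abscissas, a null set, so the horizontal parts
  inside \<open>B\<close> cover almost every \<open>z\<close> of the interval.\<close>

lemma len_ge_fst:
  assumes "finite F" "\<forall>s\<in>F. axis_parallel s" "B \<in> sets borel"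
    "\<And>z. a < z \<Longrightarrow> z < b \<Longrightarrow> \<exists>v. (z, v) \<in> region F \<inter> B"
  shows "b - a \<le> len F B"
proof -
  have "{a<..<b} \<subseteq> (\<Union>s\<in>F. hset s B) \<union> (\<lambda>s. fst (fst s)) ` F"
  proof
    fix z assume "z \<in> {a<..<b}"
    then obtain v s where s: "s \<in> F" "(z, v) \<in> seg_points s" "(z, v) \<in> B"
      using assms(4)[of z] unfolding region_def by auto
    then consider "snd (fst s) = snd (snd s)" "fst (fst s) \<le> fst (snd s)"
      | "fst (fst s) = fst (snd s)" "snd (fst s) \<le> snd (snd s)"
      using assms(2) unfolding axis_parallel_def by blast
    then show "z \<in> (\<Union>s\<in>F. hset s B) \<union> (\<lambda>s. fst (fst s)) ` F"
    proof cases
      case 1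
      then have "z \<in> hset s B" using s by (auto simp: hset_def seg_points_horizontal)
      then show ?thesis using s(1) by blast
    next
      case 2
      then have "z = fst (fst s)" using s(2) by (auto simp: seg_points_vertical)
      then show ?thesis using s(1) by blast
    qed
  qed
  then have "b - a \<le> (\<Sum>s\<in>F. measure lborel (hset s B))"
    using assms by (intro measure_cover_le) (auto intro: hset_fmeasurable)
  also have "\<dots> \<le> len F B" unfolding len_def by (intro sum_mono) simp
  finally show ?thesis .
qed

lemma len_ge_snd:
  assumes "finite F" "\<forall>s\<in>F. axis_parallel s" "B \<in> sets borel"
    "\<And>v. a < v \<Longrightarrow> v < b \<Longrightarrow> \<exists>z. (z, v) \<in> region F \<inter> B"
  shows "b - a \<le> len F B"
proof -
  have "{a<..<b} \<subseteq> (\<Union>s\<in>F. vset s B) \<union> (\<lambda>s. snd (fst s)) ` F"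
  proof
    fix v assume "v \<in> {a<..<b}"
    then obtain z s where s: "s \<in> F" "(z, v) \<in> seg_points s" "(z, v) \<in> B"
      using assms(4)[of v] unfolding region_def by auto
    then consider "snd (fst s) = snd (snd s)" "fst (fst s) \<le> fst (snd s)"
      | "fst (fst s) = fst (snd s)" "snd (fst s) \<le> snd (snd s)"
      using assms(2) unfolding axis_parallel_def by blast
    then show "v \<in> (\<Union>s\<in>F. vset s B) \<union> (\<lambda>s. snd (fst s)) ` F"
    proof cases
      case 2
      then have "v \<in> vset s B" using s by (auto simp: vset_def seg_points_vertical)
      then show ?thesis using s(1) by blast
    next
      case 1
      then have "v = snd (fst s)" using s(2) by (auto simp: seg_points_horizontal)
      then show ?thesis using s(1) by blast
    qed
  qed
  then have "b - a \<le> (\<Sum>s\<in>F. measure lborel (vset s B))"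
    using assms by (intro measure_cover_le) (auto intro: vset_fmeasurable)
  also have "\<dots> \<le> len F B" unfolding len_def by (intro sum_mono) simp
  finally show ?thesis .
qed

lemma len_rectangle_ge:
  assumes "finite S" "\<forall>s\<in>S. axis_parallel s" "connects S (x, t)" "w \<le> x"
  shows "min w h \<le> len S ({x - w<..x} \<times> {t - h<..t})"
proof -
  have B: "{x - w<..x} \<times> {t - h<..t} \<in> sets borel" by (simp add: borel_Times)
  from connects_crosses_rectangle[OF assms(3,4), of h] show ?thesis
  proof
    assume "\<forall>z\<in>{x - w<..x}. \<exists>v\<in>{t - h<..t}. (z, v) \<in> region S"
    then have "x - (x - w) \<le> len S ({x - w<..x} \<times> {t - h<..t})"
      by (intro len_ge_fst assms B) force
    then show ?thesis by simp
  next
    assume "\<forall>v\<in>{t - h<..t}. \<exists>z\<in>{x - w<..x}. (z, v) \<in> region S"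
    then have "t - (t - h) \<le> len S ({x - w<..x} \<times> {t - h<..t})"
      by (intro len_ge_snd assms B) force
    then show ?thesis by simp
  qed
qed

text \<open>The source of the bounds on the optimum in the analysis of the algorithm. Half-open
  rectangles may touch and still be disjoint.\<close>

lemma sum_rectangles_le_cost:
  assumes "finite S" "\<forall>s\<in>S. axis_parallel s" "finite I"
    "\<And>i. i \<in> I \<Longrightarrow> connects S (x i, t i)" "\<And>i. i \<in> I \<Longrightarrow> w i \<le> x i"
    "disjoint_family_on (\<lambda>i. {x i - w i<..x i} \<times> {t i - h i<..t i}) I"
  shows "(\<Sum>i\<in>I. min (w i) (h i)) \<le> cost S"
proof -
  have "(\<Sum>i\<in>I. min (w i) (h i)) \<le> (\<Sum>i\<in>I. len S ({x i - w i<..x i} \<times> {t i - h i<..t i}))"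
    using assms by (intro sum_mono len_rectangle_ge) auto
  also have "\<dots> \<le> len S UNIV"
    using assms by (intro len_superadditive) (auto simp: borel_Times)
  also have "\<dots> \<le> cost S" using assms(2) by (rule len_UNIV_le_cost)
  finally show ?thesis .
qed

lemma fst_le_cost:
  assumes "finite S" "\<forall>s\<in>S. axis_parallel s" "connects S (x, t)"
  shows "x \<le> cost S"
  \<comment> \<open>A single square of side \<open>x\<close>; only its width is limited by
    \<open>x\<close>, so it may reach below the axis.\<close>
  using sum_rectangles_le_cost[of S "{()}" "\<lambda>_. x" "\<lambda>_. t" "\<lambda>_. x" "\<lambda>_. x"] assms
  by (simp add: disjoint_family_on_def)

text \<open>A square of side \<open>t\<close> need not fit between the axis and
  \<open>(x, t)\<close>, so the heights met by the path are measured instead.\<close>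

lemma snd_le_cost:
  assumes "finite S" "\<forall>s\<in>S. axis_parallel s" "connects S (x, t)"
  shows "t \<le> cost S"
proof -
  obtain g where "monotone_path g" and g: "g 0 = (0, 0)" "\<forall>s\<in>{0..1}. g s \<in> region S \<union> {(0, 0)}"
    "\<forall>s\<in>{0..1}. \<forall>z. snd (g s) \<le> z \<and> z \<le> snd (x, t) \<longrightarrow> (\<exists>r\<in>{s..1}. snd (g r) = z)"
    using connects_path[OF assms(3)] by (elim exE conjE) (rule that, assumption+)
  have "\<exists>z. (z, v) \<in> region S \<inter> UNIV" if v: "0 < v" "v < t" for v
  proof -
    obtain r where r: "r \<in> {0..1}" "snd (g r) = v" using g(3)[rule_format, of 0 v] v g(1) by auto
    then have "g r \<in> region S" using g(2) r(1) v by fastforce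
    then show ?thesis using r(2) by (metis IntI UNIV_I prod.collapse)
  qed
  then have "t - 0 \<le> len S UNIV" by (intro len_ge_snd assms) auto
  then show ?thesis using len_UNIV_le_cost[OF assms(2)] by simp
qed

section \<open>The optimum, and inputs extended by further requests\<close>

lemma opt_le_cost: "feasible S P \<Longrightarrow> opt P \<le> cost S"
  unfolding opt_def by (intro cInf_lower) (auto intro!: bdd_belowI[of _ 0] cost_nonneg)

lemma opt_greatest:
  assumes "feasible S P" "\<And>S. feasible S P \<Longrightarrow> c \<le> cost S"
  shows "c \<le> opt P"
  unfolding opt_def by (intro cInf_greatest) (use assms in auto)

lemma drawn_mono: "drawn A ps \<subseteq> drawn A (ps @ qs)"
proof -
  have "A (take i ps) \<subseteq> drawn A (ps @ qs)" if "i \<in> {1..length ps}" for i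
  proof -
    have "take i ps = take i (ps @ qs)" using that by simp
    then show ?thesis using that unfolding drawn_def by force
  qed
  then show ?thesis unfolding drawn_def by blast
qed

lemma drawn_Nil: "drawn A [] = {}"
  by (simp add: drawn_def)

lemma drawn_snoc: "drawn A (ps @ [p]) = drawn A ps \<union> A (ps @ [p])"
proof -
  have "{1..length (ps @ [p])} = insert (length (ps @ [p])) {1..length ps}" by auto
  moreover have "A (take i (ps @ [p])) = A (take i ps)" if "i \<in> {1..length ps}" for i
    using that by simp
  ultimately show ?thesis unfolding drawn_def by auto
qed

definition last_y :: "point list \<Rightarrow> real" where
  "last_y ps = (if ps = [] then 0 else snd (last ps))"

lemma prev_y_snoc: "prev_y (ps @ [p]) = last_y ps"
  by (auto simp: prev_y_def last_y_def nth_append last_conv_nth Suc_le_eq)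

lemma rsa_input_le_last_y: "rsa_input ps \<Longrightarrow> p \<in> set ps \<Longrightarrow> snd p \<le> last_y ps"
proof (induction ps rule: rev_induct)
  case (snoc q ps)
  then show ?case by (auto simp: rsa_input_def last_y_def sorted_append)
qed simp

lemma last_y_snoc [simp]: "last_y (ps @ [p]) = snd p"
  by (simp add: last_y_def)

lemma last_y_nonneg: "rsa_input ps \<Longrightarrow> 0 \<le> last_y ps"
  by (auto simp: last_y_def rsa_input_def)

lemma rsa_input_Nil: "rsa_input []"
  by (simp add: rsa_input_def)

lemma rsa_input_snoc:
  assumes "rsa_input ps" "p \<notin> set ps" "0 \<le> fst p" "last_y ps \<le> snd p"
  shows "rsa_input (ps @ [p])"
  using assms rsa_input_le_last_y[OF assms(1)] last_y_nonneg[OF assms(1)]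
  by (fastforce simp: rsa_input_def sorted_append)

lemma rsa_input_appendD: "rsa_input (ps @ qs) \<Longrightarrow> rsa_input ps"
  by (auto simp: rsa_input_def sorted_append)

section \<open>The online algorithm\<close>

type_synonym slots = "int \<times> int \<Rightarrow> real \<times> real"

text \<open>Slot \<open>(k, m)\<close> stands for the interval \<open>[m d\<^sup>k, (m + 1) d\<^sup>k)\<close>; it stores the location of
  a copy in this interval and the time until which the copy is kept.\<close>

definition live :: "slots \<Rightarrow> real \<Rightarrow> (int \<times> int) set" where
  "live \<sigma> t = {s. t \<le> snd (\<sigma> s)}"

text \<open>Location \<open>0\<close> carries a permanent copy, so every request has a copy to its
  left.\<close>

definition columns :: "slots \<Rightarrow> real \<Rightarrow> real set" where
  "columns \<sigma> t = insert 0 ((\<lambda>s. fst (\<sigma> s)) ` live \<sigma> t)"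

definition source :: "slots \<Rightarrow> point \<Rightarrow> real" where
  "source \<sigma> p = Max {c \<in> columns \<sigma> (snd p). c \<le> fst p}"

definition side :: "nat \<Rightarrow> slots \<Rightarrow> point \<Rightarrow> real" where
  "side d \<sigma> p = (fst p - source \<sigma> p) / (real d + 1)"

text \<open>For \<open>0 < L\<close> and \<open>0 \<le> w\<close> these are the indices of the
  half-open cells of length \<open>L\<close> that meet the interval from \<open>x - w\<close> to
  \<open>x\<close>.\<close>

definition cells :: "real \<Rightarrow> real \<Rightarrow> real \<Rightarrow> int set" where
  "cells L x w = {m. of_int m * L \<le> x \<and> x - w < (of_int m + 1) * L}"

text \<open>The lower cutoff \<open>\<mu>\<close> leaves finitely many levels; the upper one makes a
  rectangle as wide as the cell fit between the axis and the request.\<close>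

definition touched :: "nat \<Rightarrow> real \<Rightarrow> slots \<Rightarrow> point \<Rightarrow> (int \<times> int) set" where
  "touched d \<mu> \<sigma> p = (if side d \<sigma> p \<le> \<mu> then {} else
     (SIGMA k:{k. \<mu> \<le> real d powi k \<and> real d powi k < fst p}. cells (real d powi k) (fst p) (side d \<sigma> p)))"

text \<open>The new copy sits at the leftmost point of the cell not left of
  \<open>fst p - side d \<sigma> p\<close>. A live slot moves only to the left, so it still serves
  all the requests that touched it; a dead one is overwritten.\<close>

definition update :: "nat \<Rightarrow> real \<Rightarrow> slots \<Rightarrow> point \<Rightarrow> slots" where
  "update d \<mu> \<sigma> p = (\<lambda>(k, m). if (k, m) \<in> touched d \<mu> \<sigma> p
     then let c = max (of_int m * real d powi k) (fst p - side d \<sigma> p)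
       in (if snd p \<le> snd (\<sigma> (k, m)) then min (fst (\<sigma> (k, m))) c else c, snd p + real d powi k)
     else \<sigma> (k, m))"

definition max_x :: "(nat \<Rightarrow> point) \<Rightarrow> nat \<Rightarrow> real" where
  "max_x p i = Max ((\<lambda>j. fst (p j)) ` {..i})"

text \<open>Expiry \<open>- 1\<close> means dead, since request times are nonnegative. The initial
  location is the left end of the cell, so a slot never points to the left of its cell.\<close>

primrec slots :: "nat \<Rightarrow> nat \<Rightarrow> (nat \<Rightarrow> point) \<Rightarrow> nat \<Rightarrow> slots" where
  "slots d H p 0 = (\<lambda>(k, m). (of_int m * real d powi k, - 1))"
| "slots d H p (Suc i) = update d (max_x p i / real H) (slots d H p i) (p i)"

lemma max_x_cong: "(\<And>j. j \<le> i \<Longrightarrow> p j = p' j) \<Longrightarrow> max_x p i = max_x p' i"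
  unfolding max_x_def by (metis (no_types, lifting) atMost_iff image_cong)

lemma slots_cong: "(\<And>j. j < i \<Longrightarrow> p j = p' j) \<Longrightarrow> slots d H p i = slots d H p' i"
proof (induction i)
  case (Suc i)
  have "max_x p i = max_x p' i" by (rule max_x_cong) (use Suc.prems in auto)
  then show ?case using Suc by simp
qed simp

lemma max_x_ge: "j \<le> i \<Longrightarrow> fst (p j) \<le> max_x p i"
  unfolding max_x_def by (intro Max_ge) auto

lemma max_x_le: "(\<And>j. j \<le> i \<Longrightarrow> fst (p j) \<le> c) \<Longrightarrow> max_x p i \<le> c"
  unfolding max_x_def by (intro Max.boundedI) auto

lemma max_x_mono: "i \<le> j \<Longrightarrow> max_x p i \<le> max_x p j"
  by (intro max_x_le max_x_ge) auto

lemma finite_columns: "finite (live \<sigma> t) \<Longrightarrow> finite (columns \<sigma> t)"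
  by (simp add: columns_def)

lemma source:
  assumes "finite (live \<sigma> (snd p))" "0 \<le> fst p"
  shows "source \<sigma> p \<in> columns \<sigma> (snd p)" "source \<sigma> p \<le> fst p" "0 \<le> source \<sigma> p"
    "\<And>c. c \<in> columns \<sigma> (snd p) \<Longrightarrow> c \<le> fst p \<Longrightarrow> c \<le> source \<sigma> p"
proof -
  let ?C = "{c \<in> columns \<sigma> (snd p). c \<le> fst p}"
  have fin: "finite ?C" using finite_columns[OF assms(1)] by simp
  have 0: "0 \<in> ?C" using assms(2) by (simp add: columns_def)
  have "source \<sigma> p \<in> ?C" unfolding source_def using fin 0 by (intro Max_in) auto
  then show "source \<sigma> p \<in> columns \<sigma> (snd p)" "source \<sigma> p \<le> fst p" by auto
  show *: "c \<le> source \<sigma> p" if "c \<in> columns \<sigma> (snd p)" "c \<le> fst p" for c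
    unfolding source_def using fin that by (intro Max_ge) auto
  show "0 \<le> source \<sigma> p" using 0 by (intro *) auto
qed

lemma cells_eq: "0 < L \<Longrightarrow> cells L x w = {\<lfloor>(x - w) / L\<rfloor>..\<lfloor>x / L\<rfloor>}"
proof -
  assume L: "0 < L"
  have "of_int m * L \<le> x \<longleftrightarrow> m \<le> \<lfloor>x / L\<rfloor>" for m
    using L by (simp add: le_floor_iff pos_le_divide_eq)
  moreover have "x - w < (of_int m + 1) * L \<longleftrightarrow> \<lfloor>(x - w) / L\<rfloor> \<le> m" for m
    using L by (simp add: floor_le_iff pos_divide_less_eq)
  ultimately show ?thesis by (auto simp: cells_def)
qed

lemma finite_cells: "0 < L \<Longrightarrow> finite (cells L x w)"
  by (simp add: cells_eq)

lemma card_cells_le: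
  assumes "0 < L" "0 \<le> w"
  shows "real (card (cells L x w)) * L \<le> w + 2 * L"
proof -
  have "(x - w) / L \<le> x / L" using assms by (intro divide_right_mono) auto
  then have "real (card (cells L x w)) = of_int \<lfloor>x / L\<rfloor> - of_int \<lfloor>(x - w) / L\<rfloor> + 1"
    using floor_mono[of "(x - w) / L" "x / L"] assms by (simp add: cells_eq of_nat_nat)
  also have "\<dots> \<le> x / L - (x - w) / L + 2" by linarith
  also have "\<dots> = (w + 2 * L) / L" using assms by (simp add: field_simps)
  finally show ?thesis using assms by (simp add: pos_le_divide_eq)
qed

section \<open>The number of levels, and one phase with fixed \<open>d\<close>\<close>

lemma powi_levels:
  assumes d: "2 \<le> d" and Z: "0 < Z"
  shows "finite {k. Z \<le> real d powi k \<and> real d powi k \<le> Z * real d ^ e}" (is "finite ?K")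
    and "card {k. Z \<le> real d powi k \<and> real d powi k \<le> Z * real d ^ e} \<le> e + 1"
proof -
  have diff: "k' \<le> k + int e" if "k \<in> ?K" "k' \<in> ?K" for k k'
  proof -
    have "real d powi k' \<le> Z * real d ^ e" using that by simp
    also have "\<dots> \<le> real d powi k * real d ^ e" using that by (intro mult_right_mono) auto
    also have "\<dots> = real d powi (k + int e)" using d by (simp add: power_int_add)
    finally show ?thesis using d power_int_strict_increasing[of "k + int e" k' "real d"] by fastforce
  qed
  have "finite ?K \<and> card ?K \<le> e + 1"
  proof (cases "?K = {}")
    case True
    then show ?thesis by (simp only: finite.emptyI card.empty) simp
  next
    case False
    then obtain k1 where k1: "k1 \<in> ?K" by blast
    have "?K \<subseteq> {k1 - int e..k1 + int e}" using diff k1 by fastforce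
    then have fin: "finite ?K" by (rule finite_subset) simp
    have "Min ?K \<in> ?K" using fin False by (rule Min_in)
    then have "?K \<subseteq> {Min ?K..Min ?K + int e}" using diff fin by fastforce
    then have "card ?K \<le> card {Min ?K..Min ?K + int e}" by (rule card_mono[rotated]) simp
    then show ?thesis using fin by simp
  qed
  then show "finite ?K" "card ?K \<le> e + 1" by auto
qed

text \<open>A phase has at most \<open>H\<close> requests, and \<open>H\<close> also fixes the
  cutoff: requests whose side is at most \<open>1 / H\<close> of the largest \<open>x\<close> touch
  nothing. The exponent \<open>e\<close> limits the levels in use to \<open>e + 1\<close>; the
  algorithm takes \<open>e = d\<close>.\<close>

locale phase =
  fixes d e H :: nat and p :: "nat \<Rightarrow> point" and n :: nat
  assumes d: "2 \<le> d" and H: "H = d ^ e" and n: "n \<le> H"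
    and x_nonneg: "\<And>i. i < n \<Longrightarrow> 0 \<le> fst (p i)"
    and t_nonneg: "\<And>i. i < n \<Longrightarrow> 0 \<le> snd (p i)"
    and t_mono: "\<And>i j. i \<le> j \<Longrightarrow> j < n \<Longrightarrow> snd (p i) \<le> snd (p j)"
begin

abbreviation "L k \<equiv> real d powi k"
abbreviation "x i \<equiv> fst (p i)"
abbreviation "t i \<equiv> snd (p i)"
abbreviation "st i \<equiv> slots d H p i"
abbreviation "\<mu> i \<equiv> max_x p i / real H"
abbreviation "w i \<equiv> side d (st i) (p i)"
abbreviation "T i \<equiv> touched d (\<mu> i) (st i) (p i)"

lemma H_pos: "0 < real H" using d H by simp

lemma L_pos: "0 < L k" using d by (intro zero_less_power_int) simp

lemma max_x_nonneg: "i < n \<Longrightarrow> 0 \<le> max_x p i"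
  using max_x_ge[of 0 i p] x_nonneg[of 0] by auto

lemma \<mu>_nonneg: "i < n \<Longrightarrow> 0 \<le> \<mu> i"
  using max_x_nonneg H_pos by simp

lemma finite_levels: "i < n \<Longrightarrow> finite {k. \<mu> i \<le> L k \<and> L k < x i}"
  and card_levels: "i < n \<Longrightarrow> card {k. \<mu> i \<le> L k \<and> L k < x i} \<le> e + 1"
proof -
  assume i: "i < n"
  have "finite {k. \<mu> i \<le> L k \<and> L k < x i} \<and> card {k. \<mu> i \<le> L k \<and> L k < x i} \<le> e + 1"
  proof (cases "max_x p i = 0")
    case True
    then have "\<not> L k < x i" for k using max_x_ge[of i i p] L_pos[of k] by linarith
    then show ?thesis by simp
  next
    case False
    then have Z: "0 < \<mu> i" using max_x_nonneg[OF i] H_pos by simp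
    have eq: "\<mu> i * real d ^ e = max_x p i" using H_pos H by simp
    have sub: "{k. \<mu> i \<le> L k \<and> L k < x i} \<subseteq> {k. \<mu> i \<le> L k \<and> L k \<le> \<mu> i * real d ^ e}"
      using max_x_ge[of i i p] eq by auto
    show ?thesis
      using finite_subset[OF sub powi_levels(1)[OF d Z]] card_mono[OF powi_levels(1)[OF d Z] sub]
        powi_levels(2)[OF d Z, of e] by linarith
  qed
  then show "finite {k. \<mu> i \<le> L k \<and> L k < x i}" "card {k. \<mu> i \<le> L k \<and> L k < x i} \<le> e + 1" by auto
qed

lemma finite_T: "i < n \<Longrightarrow> finite (T i)"
  unfolding touched_def using finite_levels finite_cells[OF L_pos] by auto

lemma st_untouched: "s \<notin> T i \<Longrightarrow> st (Suc i) s = st i s"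
  by (cases s) (simp add: update_def)

lemma st_touched:
  assumes "(k, m) \<in> T i"
  shows "fst (st (Suc i) (k, m)) = (if t i \<le> snd (st i (k, m))
      then min (fst (st i (k, m))) (max (of_int m * L k) (x i - w i))
      else max (of_int m * L k) (x i - w i))"
    "snd (st (Suc i) (k, m)) = t i + L k"
  using assms by (simp_all add: update_def Let_def)

text \<open>A slot that was never touched keeps its expiry \<open>- 1\<close>. This makes the live
  slots finite although there are infinitely many slots.\<close>

lemma support: "i \<le> n \<Longrightarrow> {s. 0 \<le> snd (st i s)} \<subseteq> (\<Union>j<i. T j)"
proof (induction i)
  case (Suc i)
  then show ?case using st_untouched[of _ i] by (fastforce simp: lessThan_Suc simp del: slots.simps(2))
qed auto

lemma live_subset: "i < n \<Longrightarrow> live (st i) (t i) \<subseteq> (\<Union>j<i. T j)"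
proof -
  assume i: "i < n"
  have "live (st i) (t i) \<subseteq> {s. 0 \<le> snd (st i s)}" using t_nonneg[OF i] by (auto simp: live_def)
  also have "\<dots> \<subseteq> (\<Union>j<i. T j)" using i by (intro support) simp
  finally show ?thesis .
qed

lemma finite_live: "i < n \<Longrightarrow> finite (live (st i) (t i))"
  by (rule finite_subset[OF live_subset]) (auto intro: finite_T)

lemma src:
  assumes "i < n"
  shows "source (st i) (p i) \<in> columns (st i) (t i)" "source (st i) (p i) \<le> x i"
    "0 \<le> source (st i) (p i)"
    "c \<in> columns (st i) (t i) \<Longrightarrow> c \<le> x i \<Longrightarrow> c \<le> source (st i) (p i)"
  using source[OF finite_live[OF assms] x_nonneg[OF assms]] by auto

lemma w: "(real d + 1) * w i = x i - source (st i) (p i)"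
proof -
  have "real d + 1 \<noteq> 0" by linarith
  then show ?thesis by (simp add: side_def)
qed

lemma w_nonneg: "i < n \<Longrightarrow> 0 \<le> w i"
  using src(2)[of i] by (simp add: side_def)

lemma w_le: "i < n \<Longrightarrow> (real d + 1) * w i \<le> x i"
  using w[of i] src(3)[of i] by simp

lemma column_ge: "of_int m * L k \<le> fst (st i (k, m))"
proof (induction i)
  case (Suc i)
  then show ?case
    by (cases "(k, m) \<in> T i") (auto simp: st_touched st_untouched simp del: slots.simps(2))
qed simp

lemma T_D:
  assumes "(k, m) \<in> T i"
  shows "\<mu> i < w i" "\<mu> i \<le> L k" "L k < x i" "of_int m * L k \<le> x i" "x i - w i < (of_int m + 1) * L k"
  using assms by (auto simp: touched_def cells_def split: if_splits)

lemma expiry_ge: "(k, m) \<in> T i \<Longrightarrow> i < j \<Longrightarrow> j \<le> n \<Longrightarrow> t i + L k \<le> snd (st j (k, m))"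
proof (induction j)
  case (Suc j)
  show ?case
  proof (cases "i = j")
    case True
    then show ?thesis using Suc.prems(1) st_touched(2) by simp
  next
    case False
    then have "t i + L k \<le> snd (st j (k, m))" "t i \<le> t j" using Suc t_mono[of i j] by auto
    then show ?thesis
      by (cases "(k, m) \<in> T j") (simp_all add: st_touched st_untouched del: slots.simps(2))
  qed
qed simp

text \<open>As long as the touch by request \<open>i\<close> has not expired, every later touch
  takes a minimum, so the copy does not move right.\<close>

lemma column_le:
  "(k, m) \<in> T i \<Longrightarrow> i < j \<Longrightarrow> j < n \<Longrightarrow> t j \<le> t i + L k \<Longrightarrow>
   fst (st j (k, m)) \<le> max (of_int m * L k) (x i - w i)"
proof (induction j)
  case (Suc j)
  show ?case
  proof (cases "i = j")
    case True
    then show ?thesis using Suc.prems(1) st_touched(1) by simp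
  next
    case False
    have tj: "t j \<le> t i + L k" using t_mono[of j "Suc j"] Suc.prems by simp
    then have "fst (st j (k, m)) \<le> max (of_int m * L k) (x i - w i)" using Suc False by simp
    moreover have "t j \<le> snd (st j (k, m))"
      using tj expiry_ge[of k m i j] Suc.prems False by simp
    ultimately show ?thesis
      by (cases "(k, m) \<in> T j") (simp_all add: st_touched st_untouched min.coboundedI1 del: slots.simps(2))
  qed
qed simp

lemma level_between:
  assumes "0 < z"
  obtains k where "z \<le> L k" "L k < real d * z"
proof -
  define k where "k = \<lceil>log d z\<rceil>"
  have d1: "1 < real d" using d by simp
  have "real d powr (log d z) = z" using assms d1 by simp
  moreover have "L k = real d powr real_of_int k" using d1 by (simp add: powr_real_of_int')
  moreover have "real d powr log d z \<le> real d powr real_of_int k"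
    using d1 by (intro powr_mono) (auto simp: k_def)
  moreover have "real d powr real_of_int k < real d powr (log d z + 1)"
    using d1 by (intro powr_less_mono) (auto simp: k_def, linarith)
  moreover have "real d powr (log d z + 1) = real d * z" using assms d1 by (simp add: powr_add)
  ultimately show ?thesis by (intro that[of k]) auto
qed

text \<open>Otherwise a level with \<open>w j \<le> L k < d * w j\<close> would keep a copy within distance
  \<open>(d + 1) * w j\<close> to the left of request \<open>j\<close>, nearer than its source.\<close>

lemma squares_apart:
  assumes "i < j" "j < n" "\<mu> i < w i" "\<mu> j < w j"
    and u: "x i - w i \<le> u" "u \<le> x i" "x j - w j < u" "u \<le> x j"
  shows "t i \<le> t j - w j"
proof (rule ccontr)
  assume "\<not> ?thesis"
  then have late: "t j - w j < t i" by simp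
  have i: "i < n" using assms by simp
  have "0 < w j" using \<mu>_nonneg[OF assms(2)] assms(4) by simp
  then obtain k where k: "w j \<le> L k" "L k < real d * w j" by (rule level_between)
  define m where "m = \<lfloor>u / L k\<rfloor>"
  have m: "of_int m * L k \<le> u" "u < (of_int m + 1) * L k"
    using of_int_floor_le[of "u / L k"] real_of_int_floor_add_one_gt[of "u / L k"] unfolding m_def
    by (simp_all only: pos_le_divide_eq[OF L_pos] pos_divide_less_eq[OF L_pos])
  have dw: "(real d + 1) * w j = real d * w j + w j" by (simp add: algebra_simps)
  have "\<mu> i \<le> \<mu> j" using max_x_mono[of i j p] assms(1) H_pos by (simp add: divide_right_mono)
  \<comment> \<open>The chain is \<open>L k < d * w j \<le> x j - w j < u \<le> x i\<close>.\<close>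
  moreover have "L k < x i" using k w_le[OF assms(2)] u dw by linarith
  ultimately have T: "(k, m) \<in> T i"
    using assms(3,4) k m u by (auto simp: touched_def cells_def)
  have tj: "t j \<le> t i + L k" using late k by simp
  have "fst (st j (k, m)) \<le> u" using column_le[OF T assms(1,2) tj] m u by auto
  moreover have "of_int m * L k \<le> fst (st j (k, m))" by (rule column_ge)
  moreover have "fst (st j (k, m)) \<in> columns (st j) (t j)"
    using expiry_ge[OF T assms(1)] assms(2) tj unfolding columns_def live_def by force
  \<comment> \<open>From \<open>u < (m + 1) * L k\<close> the source lies right of
    \<open>u - L k\<close>, hence right of \<open>x j - (d + 1) * w j\<close>, which is its exact
    location.\<close>
  ultimately have "of_int m * L k \<le> source (st j) (p j)"
    using src(4)[OF assms(2), of "fst (st j (k, m))"] u by simp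
  then show False using m u k w[of j] dw by (simp add: algebra_simps)
qed

lemma sum_w_le:
  assumes S: "finite S" "\<forall>s\<in>S. axis_parallel s" "\<And>i. i < n \<Longrightarrow> connects S (p i)"
  shows "(\<Sum>i | i < n \<and> \<mu> i < w i. w i) \<le> cost S"
proof -
  let ?I = "{i. i < n \<and> \<mu> i < w i}"
  let ?R = "\<lambda>i. {x i - w i<..x i} \<times> {t i - w i<..t i}"
  have "?R i \<inter> ?R j = {}" if "i < j" "i \<in> ?I" "j \<in> ?I" for i j
  proof (rule ccontr)
    assume "?R i \<inter> ?R j \<noteq> {}"
    then obtain z where z: "z \<in> ?R i" "z \<in> ?R j" by blast
    have "t i \<le> t j - w j"
    proof (rule squares_apart)
      show "x i - w i \<le> min (x i) (x j)" "x j - w j < min (x i) (x j)"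
        using z unfolding mem_Times_iff greaterThanAtMost_iff by linarith+
    qed (use that in \<open>simp_all only: mem_Collect_eq min.cobounded1 min.cobounded2\<close>)
    then show False using z unfolding mem_Times_iff greaterThanAtMost_iff by linarith
  qed
  then have "?R i \<inter> ?R j = {}" if "i \<noteq> j" "i \<in> ?I" "j \<in> ?I" for i j
    using that by (cases i j rule: linorder_cases) (blast+)
  then have "disjoint_family_on ?R ?I" unfolding disjoint_family_on_def by blast
  moreover have "w i \<le> x i" if "i < n" for i
  proof -
    have "1 * w i \<le> (real d + 1) * w i" using w_nonneg[OF that] by (intro mult_right_mono) auto
    then show ?thesis using w_le[OF that] by simp
  qed
  ultimately have "(\<Sum>i\<in>?I. min (w i) (w i)) \<le> cost S"
    using S by (intro sum_rectangles_le_cost) auto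
  then show ?thesis by simp
qed

text \<open>This pays for the requests below the cutoff: there are at most \<open>H\<close> of them,
  so together they cost at most the largest \<open>x\<close>, which every solution has to
  reach.\<close>

lemma sum_max_x_le:
  assumes S: "finite S" "\<forall>s\<in>S. axis_parallel s" "\<And>i. i < n \<Longrightarrow> connects S (p i)"
  shows "real n * (max_x p (n - 1) / real H) \<le> cost S"
proof (cases "n = 0")
  case False
  have "max_x p (n - 1) \<le> cost S"
  proof (rule max_x_le)
    fix j assume "j \<le> n - 1"
    then have "connects S (x j, t j)" using S(3)[of j] False by simp
    then show "x j \<le> cost S" by (rule fst_le_cost[OF S(1,2)])
  qed
  moreover have "0 \<le> max_x p (n - 1)" using False by (intro max_x_nonneg) auto
  moreover have "real n \<le> real H" using n by (metis of_nat_le_iff)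
  ultimately have "real n * max_x p (n - 1) \<le> real H * cost S" by (intro mult_mono) auto
  then show ?thesis using H_pos by (simp add: pos_divide_le_eq mult.commute)
qed (simp add: cost_nonneg)

lemma horizontal_le:
  assumes S: "finite S" "\<forall>s\<in>S. axis_parallel s" "\<And>i. i < n \<Longrightarrow> connects S (p i)"
  shows "(\<Sum>i<n. x i - source (st i) (p i)) \<le> 2 * (real d + 1) * cost S"
proof -
  let ?M = "max_x p (n - 1) / real H"
  have M: "\<mu> i \<le> ?M" if "i < n" for i
    using that max_x_mono[of i "n - 1" p] H_pos by (intro divide_right_mono) auto
  have "(\<Sum>i<n. w i) \<le> (\<Sum>i<n. (if \<mu> i < w i then w i else 0) + ?M)"
  proof (rule sum_mono)
    fix i assume "i \<in> {..<n}"
    then show "w i \<le> (if \<mu> i < w i then w i else 0) + ?M"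
      using M[of i] \<mu>_nonneg[of i] by auto
  qed
  also have "\<dots> = (\<Sum>i | i < n \<and> \<mu> i < w i. w i) + real n * ?M"
  proof -
    have "(\<Sum>i<n. if \<mu> i < w i then w i else 0) = (\<Sum>i | i < n \<and> \<mu> i < w i. w i)"
      by (rule sum.mono_neutral_cong_right) auto
    then show ?thesis by (simp add: sum.distrib)
  qed
  also have "\<dots> \<le> cost S + cost S" by (intro add_mono sum_w_le sum_max_x_le S)
  finally have "(\<Sum>i<n. w i) \<le> 2 * cost S" by simp
  then have "(real d + 1) * (\<Sum>i<n. w i) \<le> (real d + 1) * (2 * cost S)" by (intro mult_left_mono) auto
  then show ?thesis by (simp add: sum_distrib_left w mult_ac)
qed

section \<open>Keeping copies, paid by the lifetime \<open>\<delta>\<close> that each touch adds to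
  a slot\<close>

definition \<delta> :: "nat \<Rightarrow> int \<times> int \<Rightarrow> real" where
  "\<delta> i s = L (fst s) - max 0 (snd (st i s) - t i)"

lemma \<delta>_le: "\<delta> i s \<le> L (fst s)"
  by (simp add: \<delta>_def)

text \<open>With \<open>t (i - 1)\<close> read as \<open>t 0\<close> for \<open>i = 0\<close>, when no slot is live.\<close>

lemma slot_kept_le:
  "0 < n \<Longrightarrow> i \<le> n \<Longrightarrow> (\<Sum>j<i. if s \<in> live (st j) (t j) then t j - t (j - 1) else 0)
     + max 0 (snd (st i s) - t (i - 1)) \<le> (\<Sum>j<i. if s \<in> T j then \<delta> j s else 0)"
proof (induction i)
  case 0
  then show ?case using t_nonneg[of 0] by (simp add: max_def split: prod.split)
next
  case (Suc i)
  obtain k m where s: "s = (k, m)" by (cases s)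
  have mono: "t (i - 1) \<le> t i" using Suc.prems t_mono[of "i - 1" i] by simp
  have "(if s \<in> live (st i) (t i) then t i - t (i - 1) else 0) + max 0 (snd (st i s) - t i)
      \<le> max 0 (snd (st i s) - t (i - 1))"
    using mono by (auto simp: live_def)
  moreover have "max 0 (snd (st (Suc i) s) - t i) \<le> max 0 (snd (st i s) - t i) + (if s \<in> T i then \<delta> i s else 0)"
    using L_pos[of k] by (cases "s \<in> T i") (auto simp: s st_touched st_untouched \<delta>_def simp del: slots.simps(2))
  moreover have "(\<Sum>j<i. if s \<in> live (st j) (t j) then t j - t (j - 1) else 0)
     + max 0 (snd (st i s) - t (i - 1)) \<le> (\<Sum>j<i. if s \<in> T j then \<delta> j s else 0)"
    using Suc by simp
  ultimately show ?case unfolding sum.lessThan_Suc diff_Suc_1 by argo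
qed

text \<open>Both sides are regrouped by slot; for a single slot, the time it is kept is at most the
  lifetime added to it.\<close>

lemma kept_le:
  "(\<Sum>i<n. real (card (live (st i) (t i))) * (t i - t (i - 1))) \<le> (\<Sum>i<n. \<Sum>s\<in>T i. \<delta> i s)"
proof (cases "n = 0")
  case False
  let ?U = "\<Union>j<n. T j"
  have U: "finite ?U" by (auto intro: finite_T)
  have "(\<Sum>i<n. real (card (live (st i) (t i))) * (t i - t (i - 1)))
      = (\<Sum>i<n. \<Sum>s\<in>?U. if s \<in> live (st i) (t i) then t i - t (i - 1) else 0)"
  proof (rule sum.cong)
    fix i assume i: "i \<in> {..<n}"
    have "live (st i) (t i) \<subseteq> ?U" using live_subset[of i] i by fastforce
    then have "?U \<inter> live (st i) (t i) = live (st i) (t i)" by blast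
    then show "real (card (live (st i) (t i))) * (t i - t (i - 1))
        = (\<Sum>s\<in>?U. if s \<in> live (st i) (t i) then t i - t (i - 1) else 0)"
      by (simp add: sum.inter_restrict[OF U, symmetric])
  qed simp
  also have "\<dots> = (\<Sum>s\<in>?U. \<Sum>i<n. if s \<in> live (st i) (t i) then t i - t (i - 1) else 0)"
    by (rule sum.swap)
  also have "\<dots> \<le> (\<Sum>s\<in>?U. \<Sum>i<n. if s \<in> T i then \<delta> i s else 0)"
  proof (rule sum_mono)
    fix s
    show "(\<Sum>i<n. if s \<in> live (st i) (t i) then t i - t (i - 1) else 0)
        \<le> (\<Sum>i<n. if s \<in> T i then \<delta> i s else 0)"
      using slot_kept_le[of n s] False by linarith
  qed
  also have "\<dots> = (\<Sum>i<n. \<Sum>s\<in>?U. if s \<in> T i then \<delta> i s else 0)"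
    by (rule sum.swap)
  also have "\<dots> = (\<Sum>i<n. \<Sum>s\<in>T i. \<delta> i s)"
  proof (rule sum.cong)
    fix i assume "i \<in> {..<n}"
    then have "?U \<inter> T i = T i" by blast
    then show "(\<Sum>s\<in>?U. if s \<in> T i then \<delta> i s else 0) = (\<Sum>s\<in>T i. \<delta> i s)"
      by (simp add: sum.inter_restrict[OF U, symmetric])
  qed simp
  finally show ?thesis .
qed simp

abbreviation "M \<equiv> max_x p (n - 1) / real H"

text \<open>The final cutoff \<open>M\<close> in place of \<open>\<mu> i\<close> puts the big levels
  of all requests into one common window of at most \<open>e + 1\<close> levels.\<close>

definition big :: "nat \<Rightarrow> int \<times> int \<Rightarrow> bool" where
  "big i s \<longleftrightarrow> w i < L (fst s) \<and> M \<le> L (fst s)"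

lemma M_nonneg: "i < n \<Longrightarrow> 0 \<le> M"
  using max_x_nonneg[of "n - 1"] H_pos by simp

text \<open>On one level the touched cells have total length at most \<open>w i + 2 * L k\<close>,
  and a level that is not big has \<open>L k \<le> w i\<close> or \<open>L k < M\<close>. There are
  at most \<open>e + 1\<close> levels.\<close>

lemma small_sum_le:
  assumes i: "i < n" "\<mu> i < w i"
  shows "(\<Sum>s\<in>T i. if big i s then 0 else \<delta> i s) \<le> 3 * (real e + 1) * (w i + M)"
proof -
  let ?K = "{k. \<mu> i \<le> L k \<and> L k < x i}" and ?c = "\<lambda>k. cells (L k) (x i) (w i)"
  have T: "T i = Sigma ?K ?c" using i by (auto simp: touched_def)
  have nn: "0 \<le> w i + M" using w_nonneg[OF i(1)] M_nonneg[OF i(1)] by simp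
  have "(\<Sum>s\<in>T i. if big i s then 0 else \<delta> i s)
      = (\<Sum>k\<in>?K. \<Sum>m\<in>?c k. if big i (k, m) then 0 else \<delta> i (k, m))"
    unfolding T by (subst sum.Sigma) (auto simp: finite_levels[OF i(1)] finite_cells[OF L_pos])
  also have "\<dots> \<le> (\<Sum>k\<in>?K. 3 * (w i + M))"
  proof (rule sum_mono)
    fix k
    show "(\<Sum>m\<in>?c k. if big i (k, m) then 0 else \<delta> i (k, m)) \<le> 3 * (w i + M)"
    proof (cases "w i < L k \<and> M \<le> L k")
      case True
      then show ?thesis using nn by (simp add: big_def)
    next
      case False
      then have "(\<Sum>m\<in>?c k. if big i (k, m) then 0 else \<delta> i (k, m)) \<le> (\<Sum>m\<in>?c k. L k)"
        using \<delta>_le[of i "(k, _)"] by (intro sum_mono) (auto simp: big_def)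
      also have "\<dots> \<le> w i + 2 * L k"
        using card_cells_le[OF L_pos w_nonneg[OF i(1)], of k "x i"] by simp
      also have "\<dots> \<le> 3 * (w i + M)"
        using False w_nonneg[OF i(1)] M_nonneg[OF i(1)] by argo
      finally show ?thesis .
    qed
  qed
  also have "\<dots> = real (card ?K) * (3 * (w i + M))" by simp
  also have "\<dots> \<le> (real e + 1) * (3 * (w i + M))"
    using card_levels[OF i(1)] nn by (intro mult_right_mono) auto
  finally show ?thesis by (simp only: mult_ac)
qed

lemma sum_small_le:
  assumes S: "finite S" "\<forall>s\<in>S. axis_parallel s" "\<And>i. i < n \<Longrightarrow> connects S (p i)"
  shows "(\<Sum>i<n. \<Sum>s\<in>T i. if big i s then 0 else \<delta> i s) \<le> 6 * (real e + 1) * cost S"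
proof -
  have "(\<Sum>i<n. \<Sum>s\<in>T i. if big i s then 0 else \<delta> i s)
      \<le> (\<Sum>i<n. 3 * (real e + 1) * ((if \<mu> i < w i then w i else 0) + M))"
  proof (rule sum_mono)
    fix i assume i: "i \<in> {..<n}"
    show "(\<Sum>s\<in>T i. if big i s then 0 else \<delta> i s)
        \<le> 3 * (real e + 1) * ((if \<mu> i < w i then w i else 0) + M)"
    proof (cases "\<mu> i < w i")
      case True
      then show ?thesis using small_sum_le[of i] i by simp
    next
      case False
      then have "T i = {}" by (simp add: touched_def)
      then have "(\<Sum>s\<in>T i. if big i s then 0 else \<delta> i s) = 0" by (simp only: sum.empty)
      also have "\<dots> \<le> 3 * (real e + 1) * M" using M_nonneg[of i] i by (intro mult_nonneg_nonneg) auto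
      finally show ?thesis using False by simp
    qed
  qed
  also have "\<dots> = 3 * (real e + 1) * ((\<Sum>i<n. if \<mu> i < w i then w i else 0) + real n * M)"
    by (simp only: sum_distrib_left[symmetric] sum.distrib sum_constant card_lessThan)
  also have "(\<Sum>i<n. if \<mu> i < w i then w i else 0) = (\<Sum>i | i < n \<and> \<mu> i < w i. w i)"
    by (rule sum.mono_neutral_cong_right) auto
  also have "3 * (real e + 1) * (\<dots> + real n * M) \<le> 3 * (real e + 1) * (cost S + cost S)"
    by (intro mult_left_mono add_mono sum_w_le sum_max_x_le S) auto
  finally show ?thesis by (simp add: algebra_simps)
qed

text \<open>The rectangles of one slot follow each other in time, and those of two slots whose
  indices differ by at least \<open>3\<close> are horizontally apart.\<close>

lemma level_sum_le:
  assumes S: "finite S" "\<forall>s\<in>S. axis_parallel s" "\<And>i. i < n \<Longrightarrow> connects S (p i)"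
    and Z: "finite Z" "\<And>i s. (i, s) \<in> Z \<Longrightarrow> i < n \<and> s \<in> T i \<and> w i < L k \<and> fst s = k \<and> snd s mod 3 = r"
  shows "(\<Sum>(i, s)\<in>Z. \<delta> i s) \<le> cost S"
proof -
  let ?R = "\<lambda>z. {x (fst z) - L k<..x (fst z)} \<times> {t (fst z) - \<delta> (fst z) (snd z)<..t (fst z)}"
  have same: "?R (i, (k, m)) \<inter> ?R (j, (k, m)) = {}"
    if "(i, (k, m)) \<in> Z" "(j, (k, m)) \<in> Z" "i < j" for i j m
  proof -
    have "t i + L k \<le> snd (st j (k, m))"
      using Z(2)[OF that(1)] Z(2)[OF that(2)] that(3) by (intro expiry_ge) simp_all
    then have "\<delta> j (k, m) \<le> t j - t i" by (simp add: \<delta>_def)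
    then show ?thesis by auto
  qed
  have far: "?R (i, (k, m)) \<inter> ?R (j, (k, m')) = {}"
    if "(i, (k, m)) \<in> Z" "(j, (k, m')) \<in> Z" "m < m'" for i j m m'
  proof -
    have m: "(k, m) \<in> T i" "w i < L k" "(k, m') \<in> T j" "m mod 3 = m' mod 3"
      using Z(2)[OF that(1)] Z(2)[OF that(2)] by simp_all
    have m': "m + 3 \<le> m'" using m(4) that(3) by presburger
    have "x i - w i < (of_int m + 1) * L k" "w i < L k" "of_int m' * L k \<le> x j"
      using T_D(5)[OF m(1)] m(2) T_D(4)[OF m(3)] .
    moreover have "(of_int m + 3) * L k \<le> of_int m' * L k"
      using m' L_pos[of k] by (intro mult_right_mono) linarith+
    \<comment> \<open>This is where the gap of \<open>3\<close> enters: \<open>x i < (m + 1) * L k +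
      w i < (m + 2) * L k \<le> (m' - 1) * L k \<le> x j - L k\<close>.\<close>
    ultimately have "x i < x j - L k" by (simp add: algebra_simps)
    then show ?thesis by auto
  qed
  have "?R z \<inter> ?R z' = {}" if z: "z \<in> Z" "z' \<in> Z" "z \<noteq> z'" for z z'
  proof -
    obtain i k1 m where z1: "z = (i, (k1, m))" by (metis prod.collapse)
    obtain j k2 m' where z2: "z' = (j, (k2, m'))" by (metis prod.collapse)
    have k: "k1 = k" "k2 = k"
      using Z(2)[OF z(1)[unfolded z1]] Z(2)[OF z(2)[unfolded z2]] by simp_all
    note z = z[unfolded z1 z2 k]
    consider "m < m'" | "m' < m" | "m = m'" "i < j" | "m = m'" "j < i"
      using z(3) by fastforce
    then show ?thesis
    proof cases
      case 1
      then show ?thesis using far[OF z(1) z(2)] unfolding z1 z2 k by (simp only: Int_commute)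
    next
      case 2
      then show ?thesis using far[OF z(2) z(1)] unfolding z1 z2 k by (simp only: Int_commute)
    next
      case 3
      then show ?thesis using same[of i m j] same[of j m i] z unfolding z1 z2 k by (simp add: Int_commute)
    next
      case 4
      then show ?thesis using same[of i m j] same[of j m i] z unfolding z1 z2 k by (simp add: Int_commute)
    qed
  qed
  then have "disjoint_family_on ?R Z" unfolding disjoint_family_on_def by blast
  moreover have "L k \<le> x (fst z) \<and> connects S (x (fst z), t (fst z))" if "z \<in> Z" for z
  proof -
    obtain i k1 m where z: "z = (i, (k1, m))" by (metis prod.collapse)
    have "i < n" "(k, m) \<in> T i" using Z(2)[OF that[unfolded z]] by auto
    then show ?thesis using T_D(3)[of k m i] S(3)[of i] by (simp add: z)
  qed
  ultimately have "(\<Sum>z\<in>Z. min (L k) (\<delta> (fst z) (snd z))) \<le> cost S"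
    using S(1,2) Z(1) by (intro sum_rectangles_le_cost) auto
  moreover have "(\<Sum>z\<in>Z. min (L k) (\<delta> (fst z) (snd z))) = (\<Sum>(i, s)\<in>Z. \<delta> i s)"
  proof (rule sum.cong)
    fix z assume "z \<in> Z"
    then have "\<delta> (fst z) (snd z) \<le> L k" using Z(2)[of "fst z" "snd z"] \<delta>_le[of "fst z" "snd z"] by simp
    then show "min (L k) (\<delta> (fst z) (snd z)) = (case z of (i, s) \<Rightarrow> \<delta> i s)" by (simp add: split_beta)
  qed simp
  ultimately show ?thesis by simp
qed

text \<open>The touches of big slots split by level and by index modulo \<open>3\<close> into at
  most \<open>3 * (e + 1)\<close> classes, each of which costs at most the optimum.\<close>

lemma sum_big_le:
  assumes S: "finite S" "\<forall>s\<in>S. axis_parallel s" "\<And>i. i < n \<Longrightarrow> connects S (p i)"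
  shows "(\<Sum>i<n. \<Sum>s\<in>T i. if big i s then \<delta> i s else 0) \<le> 3 * (real e + 1) * cost S"
proof (cases "\<exists>i<n. T i \<noteq> {}")
  case True
  let ?K = "{k. M \<le> L k \<and> L k \<le> M * real d ^ e}" and ?Z = "SIGMA i:{..<n}. {s \<in> T i. big i s}"
  let ?g = "\<lambda>z::nat \<times> int \<times> int. (fst (snd z), snd (snd z) mod 3)"
  have MH: "M * real d ^ e = max_x p (n - 1)" using H_pos H by simp
  have le: "x i \<le> max_x p (n - 1)" if "i < n" for i using that by (intro max_x_ge) simp
  have "0 < M"
  proof -
    obtain i k m where "i < n" "(k, m) \<in> T i" using True by fastforce
    then have "L k < max_x p (n - 1)" using T_D(3)[of k m i] le[of i] by simp
    then show ?thesis using L_pos[of k] H_pos by simp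
  qed
  then have K: "finite ?K" "card ?K \<le> e + 1" using powi_levels[OF d] by blast+
  have Zfin: "finite ?Z" using finite_T by (intro finite_SigmaI) auto
  have "(\<Sum>i<n. \<Sum>s\<in>T i. if big i s then \<delta> i s else 0) = (\<Sum>i<n. \<Sum>s\<in>{s \<in> T i. big i s}. \<delta> i s)"
    by (rule sum.cong) (simp_all add: sum.inter_filter[OF finite_T])
  also have "\<dots> = (\<Sum>(i, s)\<in>?Z. \<delta> i s)" using finite_T by (intro sum.Sigma) auto
  also have "\<dots> = (\<Sum>y\<in>?K \<times> {0, 1, 2}. \<Sum>(i, s)\<in>{z \<in> ?Z. ?g z = y}. \<delta> i s)"
  proof (rule sum.group[symmetric])
    show "?g ` ?Z \<subseteq> ?K \<times> {0, 1, 2}"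
    proof
      fix y assume "y \<in> ?g ` ?Z"
      then obtain i k m where y: "y = (k, m mod 3)" "i < n" "(k, m) \<in> T i" "big i (k, m)" by auto
      have "k \<in> ?K" using T_D(3)[OF y(3)] le[OF y(2)] y(4) MH by (simp add: big_def)
      moreover have "m mod 3 \<in> {0, 1, 2}" by auto
      ultimately show "y \<in> ?K \<times> {0, 1, 2}" unfolding y(1) by (rule SigmaI)
    qed
  qed (use Zfin K in auto)
  also have "\<dots> \<le> (\<Sum>y\<in>?K \<times> {0::int, 1, 2}. cost S)"
  proof (rule sum_mono)
    fix y
    show "(\<Sum>(i, s)\<in>{z \<in> ?Z. ?g z = y}. \<delta> i s) \<le> cost S"
      using Zfin by (intro level_sum_le[OF S, where k = "fst y" and r = "snd y"]) (auto simp: big_def)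
  qed
  also have "\<dots> = real (card ?K) * 3 * cost S" by (simp add: card_cartesian_product)
  also have "\<dots> \<le> (real e + 1) * 3 * cost S" using K(2) cost_nonneg[of S] by (intro mult_right_mono) linarith+
  finally show ?thesis by (simp only: mult_ac)
next
  case False
  then have "(\<Sum>i<n. \<Sum>s\<in>T i. if big i s then \<delta> i s else 0) = 0" by (intro sum.neutral) auto
  then show ?thesis using cost_nonneg[of S] by simp
qed

lemma phase_cost_le:
  assumes S: "finite S" "\<forall>s\<in>S. axis_parallel s" "\<And>i. i < n \<Longrightarrow> connects S (p i)"
  shows "(\<Sum>i<n. real (card (live (st i) (t i))) * (t i - t (i - 1)) + (x i - source (st i) (p i)))
    \<le> (9 * (real e + 1) + 2 * (real d + 1)) * cost S"
proof -
  have "(\<Sum>i<n. \<Sum>s\<in>T i. \<delta> i s) = (\<Sum>i<n. \<Sum>s\<in>T i. if big i s then 0 else \<delta> i s)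
      + (\<Sum>i<n. \<Sum>s\<in>T i. if big i s then \<delta> i s else 0)"
    unfolding sum.distrib[symmetric] by (intro sum.cong) auto
  then have "(\<Sum>i<n. \<Sum>s\<in>T i. \<delta> i s) \<le> 9 * (real e + 1) * cost S"
    using sum_small_le[OF S] sum_big_le[OF S] by (simp add: algebra_simps)
  then show ?thesis using kept_le horizontal_le[OF S] unfolding sum.distrib distrib_right by linarith
qed

text \<open>Copies are never placed where nothing is drawn: a new location lies between
  \<open>x i - w i\<close> and \<open>x i\<close>, and
  \<open>w i \<le> (d + 1) * w i = x i - source (st i) (p i)\<close> puts it on the delivery
  segment.\<close>

lemma columns_after:
  assumes i: "i < n" and c: "c \<in> columns (st (Suc i)) (t i)"
  shows "c \<in> columns (st i) (t i) \<or> source (st i) (p i) \<le> c \<and> c \<le> x i"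
proof -
  consider "c = 0" | k m where "t i \<le> snd (st (Suc i) (k, m))" "c = fst (st (Suc i) (k, m))"
    using c by (auto simp: columns_def live_def simp del: slots.simps(2))
  then show ?thesis
  proof cases
    case 1
    then show ?thesis by (simp add: columns_def)
  next
    case (2 k m)
    have old: "fst (st i (k, m)) \<in> columns (st i) (t i)" if "t i \<le> snd (st i (k, m))"
      using that by (force simp: columns_def live_def)
    show ?thesis
    proof (cases "(k, m) \<in> T i")
      case True
      let ?c = "max (of_int m * L k) (x i - w i)"
      have "1 * w i \<le> (real d + 1) * w i" using w_nonneg[OF i] by (intro mult_right_mono) auto
      then have "source (st i) (p i) \<le> ?c" "?c \<le> x i" using w[of i] T_D(4)[OF True] w_nonneg[OF i] by auto
      moreover have "c = ?c \<or> t i \<le> snd (st i (k, m)) \<and> c = fst (st i (k, m))"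
        unfolding 2(2) st_touched(1)[OF True] by (auto simp: min_def)
      ultimately show ?thesis using old by blast
    next
      case False
      then show ?thesis using 2 old by (simp add: st_untouched del: slots.simps(2))
    qed
  qed
qed

end

section \<open>Division of the requests into phases with doubling \<open>d\<close>\<close>

definition cap :: "nat \<Rightarrow> nat" where
  "cap q = (if q = 0 then 0 else (2 ^ q) ^ (2 ^ q))"

lemma cap_Suc: "cap (Suc q) = (2 ^ Suc q) ^ (2 ^ Suc q)"
  by (simp add: cap_def)

lemma cap_less_Suc: "cap q < cap (Suc q)"
proof (cases "q = 0")
  case False
  have "((2::nat) ^ q) ^ (2 ^ q) < (2 ^ Suc q) ^ (2 ^ q)" by (intro power_strict_mono) auto
  also have "\<dots> \<le> (2 ^ Suc q) ^ (2 ^ Suc q)" by (intro power_increasing) auto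
  finally show ?thesis using False unfolding cap_Suc by (simp add: cap_def)
qed (simp add: cap_def)

lemma strict_mono_cap: "strict_mono cap"
  using cap_less_Suc by (rule strict_monoI_Suc)

definition phase_of :: "nat \<Rightarrow> nat" where
  "phase_of j = (LEAST q. j < cap (Suc q))"

lemma phase_of: "cap (phase_of j) \<le> j" "j < cap (Suc (phase_of j))"
proof -
  have "j < cap (Suc j)" using strict_mono_imp_increasing[OF strict_mono_cap, of "Suc j"] by simp
  then show "j < cap (Suc (phase_of j))" unfolding phase_of_def by (rule LeastI)
  show "cap (phase_of j) \<le> j"
  proof (cases "phase_of j")
    case 0
    then show ?thesis by (simp add: cap_def)
  next
    case (Suc q)
    then have "\<not> j < cap (Suc q)" using not_less_Least[of q "\<lambda>q. j < cap (Suc q)"] by (simp add: phase_of_def)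
    then show ?thesis using Suc by simp
  qed
qed

lemma phase_of_eq:
  assumes "cap q \<le> j" "j < cap (Suc q)"
  shows "phase_of j = q"
proof -
  have "cap q < cap (Suc (phase_of j))" "cap (phase_of j) < cap (Suc q)"
    using assms phase_of[of j] by linarith+
  then show ?thesis using strict_mono_less[OF strict_mono_cap] by simp
qed

text \<open>Phase \<open>q\<close> has \<open>d = 2 ^ Suc q\<close> and
  \<open>H = d ^ d = cap (Suc q)\<close>, and its requests have indices from \<open>cap q\<close>
  on; \<open>cap 0 = 0\<close> lets phase \<open>0\<close> start with the first request. Every phase
  starts with dead slots, so only the copy at \<open>0\<close> survives a change of phase.\<close>

definition phase_slots :: "point list \<Rightarrow> nat \<Rightarrow> nat \<Rightarrow> slots" where
  "phase_slots ps q = slots (2 ^ Suc q) (cap (Suc q)) (\<lambda>i. ps ! (cap q + i))"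

definition current :: "point list \<Rightarrow> slots" where
  "current ps = (let q = phase_of (length ps) in phase_slots ps q (length ps - cap q))"

text \<open>Only copies still live at the time of the new request are extended; a copy expiring in
  between stops at the previous request.\<close>

definition serve :: "slots \<Rightarrow> real \<Rightarrow> point \<Rightarrow> segment set" where
  "serve \<sigma> t p = (\<lambda>c. ((c, t), (c, snd p))) ` columns \<sigma> (snd p) \<union> {((source \<sigma> p, snd p), p)}"

definition alg :: algorithm where
  "alg ps = (if ps = [] then {} else serve (current (butlast ps)) (prev_y ps) (last ps))"

lemma alg_snoc: "alg (ps @ [p]) = serve (current ps) (last_y ps) p"
  by (simp add: alg_def prev_y_snoc)

lemma phase_input:
  assumes "rsa_input ps"
  shows "phase (2 ^ Suc q) (2 ^ Suc q) (cap (Suc q)) (\<lambda>i. ps ! (cap q + i))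
    (min (length ps) (cap (Suc q)) - cap q)"
proof
  show "(2::nat) \<le> 2 ^ Suc q" by simp
  show "snd (ps ! (cap q + i)) \<le> snd (ps ! (cap q + j))"
    if "i \<le> j" "j < min (length ps) (cap (Suc q)) - cap q" for i j
    using that assms sorted_nth_mono[of "map snd ps" "cap q + i" "cap q + j"]
    by (auto simp: rsa_input_def)
qed (use assms in \<open>auto simp: cap_Suc rsa_input_def\<close>)

lemma phase_slots_append:
  "cap q + i \<le> length ps \<Longrightarrow> phase_slots (ps @ qs) q i = phase_slots ps q i"
  unfolding phase_slots_def by (intro slots_cong) (auto simp: nth_append)

lemma columns_0: "0 \<le> t \<Longrightarrow> columns (phase_slots ps q 0) t = {0}"
  by (auto simp: columns_def live_def phase_slots_def)

lemma current_snoc: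
  assumes inp: "rsa_input (ps @ [p])"
  shows "finite (live (current ps) (snd p))"
    and "c \<in> columns (current (ps @ [p])) (snd p) \<Longrightarrow>
      c \<in> columns (current ps) (snd p) \<or> source (current ps) p \<le> c \<and> c \<le> fst p"
proof -
  let ?q = "phase_of (length ps)"
  let ?b = "cap ?q" and ?i = "length ps - cap (phase_of (length ps))"
  let ?n = "min (length (ps @ [p])) (cap (Suc ?q)) - ?b"
  have b: "?b \<le> length ps" "length ps < cap (Suc ?q)" by (rule phase_of)+
  interpret phase "2 ^ Suc ?q" "2 ^ Suc ?q" "cap (Suc ?q)" "\<lambda>i. (ps @ [p]) ! (?b + i)" ?n
    by (rule phase_input[OF inp])
  have i: "?i < ?n" using b by simp
  have cur: "current ps = phase_slots (ps @ [p]) ?q ?i"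
    unfolding current_def Let_def using b by (simp add: phase_slots_append)
  have last: "(ps @ [p]) ! (?b + ?i) = p" using b by simp
  show "finite (live (current ps) (snd p))"
    using finite_live[OF i] unfolding cur phase_slots_def last by simp
  show "c \<in> columns (current ps) (snd p) \<or> source (current ps) p \<le> c \<and> c \<le> fst p"
    if c: "c \<in> columns (current (ps @ [p])) (snd p)"
  proof (cases "length (ps @ [p]) < cap (Suc ?q)")
    case True
    then have "phase_of (length (ps @ [p])) = ?q" using b by (intro phase_of_eq) auto
    then have "current (ps @ [p]) = phase_slots (ps @ [p]) ?q (Suc ?i)"
      using b by (simp add: current_def Let_def Suc_diff_le)
    then show ?thesis using columns_after[OF i, of c] c unfolding cur phase_slots_def last by simp
  next
    case False
    then have eq: "length (ps @ [p]) = cap (Suc ?q)" using b by simp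
    then have "phase_of (length (ps @ [p])) = Suc ?q" using cap_less_Suc by (intro phase_of_eq) auto
    then have "current (ps @ [p]) = phase_slots (ps @ [p]) (Suc ?q) 0"
      using eq by (simp add: current_def)
    moreover have "0 \<le> snd p" using inp by (simp add: rsa_input_def)
    ultimately have "c = 0" using c by (simp add: columns_0)
    then show ?thesis by (simp add: columns_def)
  qed
qed

lemma columns_antimono: "s \<le> t \<Longrightarrow> columns \<sigma> t \<subseteq> columns \<sigma> s"
  by (auto simp: columns_def live_def)

text \<open>Feasibility alone is not inductive: the first conjunct says that each stored copy really
  is connected to the root at the current time.\<close>

lemma alg_connects:
  "rsa_input ps \<Longrightarrow> (\<forall>c\<in>columns (current ps) (last_y ps). connects (drawn alg ps) (c, last_y ps)) \<and>
     feasible (drawn alg ps) (set ps)"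
proof (induction ps rule: rev_induct)
  case Nil
  have "phase_of 0 = 0" by (rule phase_of_eq) (auto simp: cap_def)
  then show ?case
    by (simp add: current_def columns_0 last_y_def connects_origin feasible_def drawn_Nil)
next
  case (snoc p ps)
  let ?\<sigma> = "current ps" and ?t = "last_y ps" and ?D = "drawn alg (ps @ [p])"
  have inp: "rsa_input ps" using snoc.prems by (rule rsa_input_appendD)
  have t: "?t \<le> snd p"
    using rsa_input_le_last_y[OF snoc.prems, of p] snoc.prems
    by (auto simp: last_y_def rsa_input_def sorted_append)
  have x: "0 \<le> fst p" using snoc.prems by (simp add: rsa_input_def)
  have fin: "finite (live ?\<sigma> (snd p))" by (rule current_snoc[OF snoc.prems])
  note src = source[OF fin x]
  have D: "?D = drawn alg ps \<union> serve ?\<sigma> ?t p" by (simp add: drawn_snoc alg_snoc)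
  have col: "connects ?D (c, snd p)" if c: "c \<in> columns ?\<sigma> (snd p)" for c
  proof (rule connects_up)
    show "connects (drawn alg ps) (c, ?t)" using snoc.IH[OF inp] columns_antimono[OF t] c by blast
    show "((c, ?t), (c, snd p)) \<in> ?D" using c by (auto simp: D serve_def)
  qed (use t D in auto)
  have row: "connects ?D (z, snd p)" if "source ?\<sigma> p \<le> z" "z \<le> fst p" for z
  proof (rule connects_right[OF col[OF src(1)]])
    show "((source ?\<sigma> p, snd p), (fst p, snd p)) \<in> ?D" by (simp add: D serve_def)
  qed (use that in auto)
  have "connects ?D p" using row[of "fst p"] src(2) by simp
  moreover have "connects ?D q" if "q \<in> set ps" for q
    using snoc.IH[OF inp] that D connects_mono[of "drawn alg ps" q ?D] by (auto simp: feasible_def)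
  moreover have "finite (serve ?\<sigma> ?t p)" "\<forall>s\<in>serve ?\<sigma> ?t p. axis_parallel s"
    using finite_columns[OF fin] t src(2) by (auto simp: serve_def axis_parallel_def)
  ultimately have "feasible ?D (set (ps @ [p]))"
    using snoc.IH[OF inp] D by (auto simp: feasible_def)
  moreover have "connects ?D (c, snd p)" if "c \<in> columns (current (ps @ [p])) (snd p)" for c
    using current_snoc(2)[OF snoc.prems that] col row by blast
  ultimately show ?case by simp
qed

lemma online_alg: "online_algorithm alg"
  unfolding online_algorithm_def
proof (intro allI impI conjI ballI)
  fix ps assume ps: "rsa_input ps \<and> ps \<noteq> []"
  then obtain qs p where qs: "ps = qs @ [p]" by (metis rev_exhaust)
  then have inp: "rsa_input (qs @ [p])" using ps by simp
  show "feasible (drawn alg ps) (set ps)" using alg_connects ps by blast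
  have t: "last_y qs \<le> snd p"
    using inp by (auto simp: last_y_def rsa_input_def sorted_append)
  have src: "source (current qs) p \<le> fst p"
    using inp by (intro source(2) current_snoc(1)) (auto simp: rsa_input_def)
  fix s assume "s \<in> alg ps"
  then consider c where "s = ((c, last_y qs), (c, snd p))" | "s = ((source (current qs) p, snd p), p)"
    unfolding qs alg_snoc serve_def by blast
  then show "seg_points s \<subseteq> {z. prev_y ps \<le> snd z}"
    using t src by cases (auto simp: seg_points_vertical seg_points_horizontal qs prev_y_snoc)
qed

section \<open>Cost of the algorithm over all phases\<close>

lemma cost_serve_le:
  assumes fin: "finite (live \<sigma> (snd p))" and t: "t \<le> snd p" and x: "0 \<le> fst p"
  shows "cost (serve \<sigma> t p) \<le> (real (card (live \<sigma> (snd p))) + 1) * (snd p - t) + (fst p - source \<sigma> p)"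
proof -
  let ?f = "\<lambda>c. ((c, t), (c, snd p))"
  have C: "finite (columns \<sigma> (snd p))" by (rule finite_columns[OF fin])
  have "cost (?f ` columns \<sigma> (snd p)) = (\<Sum>c\<in>columns \<sigma> (snd p). snd p - t)"
    unfolding cost_def using t
    by (subst sum.reindex) (auto simp: inj_on_def dist_prod_def dist_real_def)
  also have "\<dots> = real (card (columns \<sigma> (snd p))) * (snd p - t)" by simp
  \<comment> \<open>The extra \<open>1\<close> is the permanent copy at \<open>0\<close>, which
    occupies no slot.\<close>
  also have "\<dots> \<le> (real (card (live \<sigma> (snd p))) + 1) * (snd p - t)"
  proof (rule mult_right_mono)
    have "card (columns \<sigma> (snd p)) \<le> Suc (card ((\<lambda>s. fst (\<sigma> s)) ` live \<sigma> (snd p)))"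
      unfolding columns_def by (rule card_insert_le_m1) auto
    also have "\<dots> \<le> Suc (card (live \<sigma> (snd p)))" using card_image_le[OF fin] by simp
    finally show "real (card (columns \<sigma> (snd p))) \<le> real (card (live \<sigma> (snd p))) + 1" by simp
  qed (use t in simp)
  finally have "cost (?f ` columns \<sigma> (snd p)) \<le> (real (card (live \<sigma> (snd p))) + 1) * (snd p - t)" .
  moreover have "cost {((source \<sigma> p, snd p), p)} = fst p - source \<sigma> p"
    using source(2)[OF fin x] by (simp add: cost_def dist_prod_def dist_real_def)
  moreover have "cost (serve \<sigma> t p) \<le> cost (?f ` columns \<sigma> (snd p)) + cost {((source \<sigma> p, snd p), p)}"
    unfolding serve_def using C by (intro cost_Un) auto
  ultimately show ?thesis by linarith
qed

definition request_cost :: "point list \<Rightarrow> nat \<Rightarrow> real" where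
  "request_cost ps j = real (card (live (current (take j ps)) (snd (ps ! j)))) *
     (snd (ps ! j) - last_y (take j ps)) + (fst (ps ! j) - source (current (take j ps)) (ps ! j))"

lemma request_cost_append: "j < length ps \<Longrightarrow> request_cost (ps @ qs) j = request_cost ps j"
  by (simp add: request_cost_def nth_append)

text \<open>The permanent copy at \<open>0\<close> telescopes to \<open>last_y ps\<close>;
  \<open>request_cost\<close> holds all the rest.\<close>

lemma cost_drawn_le:
  "rsa_input ps \<Longrightarrow> cost (drawn alg ps) \<le> last_y ps + (\<Sum>j<length ps. request_cost ps j)"
proof (induction ps rule: rev_induct)
  case Nil
  show ?case by (simp add: drawn_Nil cost_def last_y_def)
next
  case (snoc p ps)
  have inp: "rsa_input ps" using snoc.prems by (rule rsa_input_appendD)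
  have t: "last_y ps \<le> snd p" and x: "0 \<le> fst p"
    using snoc.prems by (auto simp: last_y_def rsa_input_def sorted_append)
  have fin: "finite (live (current ps) (snd p))" by (rule current_snoc[OF snoc.prems])
  have "cost (drawn alg (ps @ [p])) \<le> cost (drawn alg ps) + cost (serve (current ps) (last_y ps) p)"
    unfolding drawn_snoc alg_snoc using alg_connects[OF inp] finite_columns[OF fin]
    by (intro cost_Un) (auto simp: feasible_def serve_def)
  also have "\<dots> \<le> (last_y ps + (\<Sum>j<length ps. request_cost ps j)) +
      ((real (card (live (current ps) (snd p))) + 1) * (snd p - last_y ps) + (fst p - source (current ps) p))"
    by (intro add_mono snoc.IH inp cost_serve_le fin t x)
  also have "\<dots> = snd p + (\<Sum>j<length ps. request_cost ps j) + request_cost (ps @ [p]) (length ps)"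
    by (simp add: request_cost_def algebra_simps)
  also have "\<dots> = last_y (ps @ [p]) + (\<Sum>j<length (ps @ [p]). request_cost (ps @ [p]) j)"
    by (simp add: request_cost_append)
  finally show ?case .
qed

lemma phase_request_cost_le:
  assumes inp: "rsa_input ps" and S: "feasible S (set ps)"
  defines "n \<equiv> \<lambda>q. min (length ps) (cap q)"
  shows "(\<Sum>j=n q..<n (Suc q). request_cost ps j) \<le> 11 * (2 ^ Suc q + 1) * cost S"
proof (cases "cap q < length ps")
  case True
  let ?d = "2 ^ Suc q :: nat" and ?p = "\<lambda>i. ps ! (cap q + i)"
  let ?n = "min (length ps) (cap (Suc q)) - cap q"
  interpret phase ?d ?d "cap (Suc q)" ?p ?n by (rule phase_input[OF inp])
  have "(\<Sum>j=n q..<n (Suc q). request_cost ps j) = (\<Sum>i<?n. request_cost ps (cap q + i))"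
    using True cap_less_Suc[of q] sum.shift_bounds_nat_ivl[of "request_cost ps" 0 "cap q" ?n]
    by (simp add: n_def min_def atLeast0LessThan add.commute)
  also have "\<dots> = (\<Sum>i<?n. real (card (live (st i) (t i))) * (t i - t (i - 1)) + (x i - source (st i) (?p i)))"
  proof (rule sum.cong)
    fix i assume "i \<in> {..<?n}"
    then have i: "cap q + i < length ps" "cap q + i < cap (Suc q)" by auto
    have "phase_of (cap q + i) = q" using i by (intro phase_of_eq) auto
    then have cur: "current (take (cap q + i) ps) = st i"
      using i phase_slots_append[of q i "take (cap q + i) ps" "drop (cap q + i) ps"]
      by (simp add: current_def phase_slots_def min_absorb2)
    show "request_cost ps (cap q + i)
        = real (card (live (st i) (t i))) * (t i - t (i - 1)) + (x i - source (st i) (?p i))"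
    proof (cases i)
      \<comment> \<open>At the start of a phase \<open>t (i - 1)\<close> is \<open>t i\<close>,
        while the previous request may be earlier. Both vertical terms vanish nevertheless, since no
        slot is live.\<close>
      case 0
      have "0 \<le> t 0" using inp i by (auto simp: rsa_input_def)
      then have "live (st 0) (t 0) = {}" by (auto simp: live_def)
      then show ?thesis using cur 0 by (simp add: request_cost_def)
    next
      case (Suc i')
      then have "last_y (take (cap q + i) ps) = t (i - 1)"
        using i by (auto simp: last_y_def last_conv_nth min_absorb2)
      then show ?thesis using cur by (simp add: request_cost_def)
    qed
  qed simp
  also have "\<dots> \<le> (9 * (real ?d + 1) + 2 * (real ?d + 1)) * cost S"
    using S by (intro phase_cost_le) (auto simp: feasible_def)
  finally show ?thesis by (simp add: algebra_simps)
next
  case False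
  then have "n q = n (Suc q)" using cap_less_Suc[of q] by (simp add: n_def)
  then show ?thesis using cost_nonneg[of S] by simp
qed

lemma alg_cost_le:
  assumes inp: "rsa_input ps" and S: "feasible S (set ps)"
  shows "cost (drawn alg ps) \<le> 34 * 2 ^ Suc (phase_of (length ps)) * cost S"
proof -
  let ?n = "\<lambda>q. min (length ps) (cap q)" and ?Q = "Suc (phase_of (length ps))"
  \<comment> \<open>Phase bounds grow geometrically: \<open>33 * 2 ^ q + 11 * (2 ^ Suc q + 1) = 55 *
    2 ^ q + 11 \<le> 66 * 2 ^ q\<close>. The copy at \<open>0\<close> raises \<open>33\<close> to
    \<open>34\<close> below.\<close>
  have sum: "(\<Sum>j<?n q. request_cost ps j) \<le> 33 * 2 ^ q * cost S" for q
  proof (induction q)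
    case (Suc q)
    have "?n q \<le> ?n (Suc q)" using cap_less_Suc[of q] by simp
    then have "(\<Sum>j<?n (Suc q). request_cost ps j) =
        (\<Sum>j<?n q. request_cost ps j) + (\<Sum>j=?n q..<?n (Suc q). request_cost ps j)"
      unfolding lessThan_atLeast0 by (intro sum.atLeastLessThan_concat[symmetric]) auto
    also have "\<dots> \<le> 33 * 2 ^ q * cost S + 11 * (2 ^ Suc q + 1) * cost S"
      using Suc phase_request_cost_le[OF inp S, of q] by linarith
    also have "\<dots> = (33 * 2 ^ q + 11 * (2 ^ Suc q + 1)) * cost S" by (simp add: algebra_simps)
    also have "\<dots> \<le> 33 * 2 ^ Suc q * cost S"
      using cost_nonneg[of S] one_le_power[of "2::real" q] by (intro mult_right_mono) auto
    finally show ?case .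
  qed (simp add: cap_def cost_nonneg)
  have "last_y ps \<le> cost S"
  proof (cases "ps = []")
    case True
    then show ?thesis by (simp add: last_y_def cost_nonneg)
  next
    case False
    then have "connects S (fst (last ps), snd (last ps))" using S by (simp add: feasible_def)
    then show ?thesis
      using S False snd_le_cost[of S "fst (last ps)" "snd (last ps)"] by (simp add: feasible_def last_y_def)
  qed
  moreover have "?n ?Q = length ps" using phase_of(2)[of "length ps"] by simp
  ultimately have "cost (drawn alg ps) \<le> 1 * cost S + 33 * 2 ^ ?Q * cost S"
    using cost_drawn_le[OF inp] sum[of ?Q] by simp
  also have "\<dots> \<le> 34 * 2 ^ ?Q * cost S"
    using mult_right_mono[of 1 "2 ^ ?Q" "cost S"] cost_nonneg[of S] one_le_power[of "2::real" ?Q]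
    by linarith
  finally show ?thesis .
qed

lemma alg_competitive: "competitive_on alg N (34 * 2 ^ Suc (phase_of N))"
  unfolding competitive_on_def
proof (intro allI impI)
  fix ps assume ps: "rsa_input ps \<and> length ps = N"
  let ?r = "34 * 2 ^ Suc (phase_of N) :: real"
  have "cost (drawn alg ps) / ?r \<le> opt (set ps)"
  proof (rule opt_greatest)
    show "feasible (drawn alg ps) (set ps)" using alg_connects ps by blast
    fix S assume "feasible S (set ps)"
    then show "cost (drawn alg ps) / ?r \<le> cost S"
      using alg_cost_le[of ps S] ps by (simp add: pos_divide_le_eq mult.commute)
  qed
  then show "cost (drawn alg ps) \<le> ?r * opt (set ps)" by (simp add: pos_divide_le_eq mult.commute)
qed

text \<open>For \<open>u = 2 ^ phase_of N\<close> and large \<open>N\<close>,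
  \<open>u * ln u \<le> ln N\<close>. Either \<open>u \<le> sqrt (ln N)\<close>, which is of smaller
  order, or \<open>ln u\<close> is at least half of \<open>ln (ln N)\<close> and \<open>u\<close> is
  at most twice the claimed function; \<open>136 = 34 * 2 * 2\<close>.\<close>

lemma phase_of_asymptotics:
  "(\<lambda>N. 34 * 2 ^ Suc (phase_of N)) \<in> O(\<lambda>N. ln (real N) / ln (ln (real N)))"
proof -
  define f :: "real \<Rightarrow> real" where "f N = ln N / ln (ln N)" for N
  have "\<forall>\<^sub>F N in at_top. 1 \<le> f N" "\<forall>\<^sub>F N in at_top. sqrt (ln N) \<le> f N"
    "\<forall>\<^sub>F N::real in at_top. 1 \<le> ln N" "\<forall>\<^sub>F N::real in at_top. 0 < ln (ln N)"
    unfolding f_def by real_asymp+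
  then have "\<forall>\<^sub>F N::real in at_top. 1 \<le> f N \<and> sqrt (ln N) \<le> f N \<and> 1 \<le> ln N \<and> 0 < ln (ln N)"
    by (simp add: eventually_conj_iff)
  then have "\<forall>\<^sub>F N in sequentially. 1 \<le> f (real N) \<and> sqrt (ln (real N)) \<le> f (real N) \<and>
      1 \<le> ln (real N) \<and> 0 < ln (ln (real N))"
    by (rule eventually_compose_filterlim) (rule filterlim_real_sequentially)
  then have "\<forall>\<^sub>F N in sequentially. norm (34 * 2 ^ Suc (phase_of N) :: real) \<le> 136 * norm (f (real N))"
  proof eventually_elim
    case (elim N)
    define u :: real where "u = 2 ^ phase_of N"
    have u1: "1 \<le> u" by (simp add: u_def)
    have N: "1 \<le> real N" using elim by (cases "N = 0") auto
    have uN: "u * ln u \<le> ln (real N)"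
    proof (cases "phase_of N = 0")
      case True
      then show ?thesis using elim by (simp add: u_def)
    next
      case False
      then have "(2 ^ phase_of N) ^ (2 ^ phase_of N) \<le> N" using phase_of(1)[of N] by (simp add: cap_def)
      then have "real ((2 ^ phase_of N) ^ (2 ^ phase_of N)) \<le> real N" by (rule of_nat_mono)
      then have "u ^ (2 ^ phase_of N) \<le> real N" by (simp add: u_def)
      then have "ln (u ^ (2 ^ phase_of N)) \<le> ln (real N)" using u1 N by (subst ln_le_cancel_iff) auto
      then show ?thesis using u1 by (simp add: ln_realpow u_def)
    qed
    have "u \<le> 2 * f (real N)"
    proof (cases "u \<le> sqrt (ln (real N))")
      case True
      then show ?thesis using elim by linarith
    next
      case False
      have "ln (sqrt (ln (real N))) \<le> ln u" using False elim u1 by (subst ln_le_cancel_iff) auto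
      then have "ln (ln (real N)) / 2 \<le> ln u" using elim by (simp add: ln_sqrt)
      then have "u * (ln (ln (real N)) / 2) \<le> ln (real N)"
        using uN mult_left_mono[of "ln (ln (real N)) / 2" "ln u" u] u1 by linarith
      then show ?thesis using elim by (simp add: f_def field_simps)
    qed
    then show ?case using elim by (simp add: u_def)
  qed
  then show ?thesis unfolding f_def by (rule bigoI)
qed

section \<open>The adversary\<close>

lemma feasible_drawn:
  assumes "online_algorithm A" "rsa_input ps"
  shows "feasible (drawn A ps) (set ps)"
  using assms by (cases "ps = []") (auto simp: online_algorithm_def feasible_def drawn_Nil)

lemma online_drawn:
  assumes "online_algorithm A" "rsa_input ps"
  shows "finite (drawn A ps)" "\<forall>s\<in>drawn A ps. axis_parallel s"
  using feasible_drawn[OF assms] by (auto simp: feasible_def)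

text \<open>One height without a copy already forces a later delivery across the whole strip;
  without such a height the slot costs the algorithm a full unit inside the strip.\<close>

definition lacks :: "real \<Rightarrow> real \<Rightarrow> segment set \<Rightarrow> real \<Rightarrow> bool" where
  "lacks a b D s \<longleftrightarrow> (\<exists>v\<in>{s<..<s + 1}. \<forall>z\<in>{a<..b}. (z, v) \<notin> region D)"

lemma lacks_antimono: "lacks a b D' s \<Longrightarrow> D \<subseteq> D' \<Longrightarrow> lacks a b D s"
  using region_mono[of D D'] by (auto simp: lacks_def)

lemma len_ge_not_lacks:
  assumes "finite F" "\<forall>s\<in>F. axis_parallel s" "\<And>n. n < T \<Longrightarrow> \<not> lacks a b F (t + real n)"
  shows "real T \<le> len F ({a<..b} \<times> {t<..t + real T})"
proof -
  let ?B = "\<lambda>n. {a<..b} \<times> {t + real n<..t + real n + 1}"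
  have "1 \<le> len F (?B n)" if "n < T" for n
  proof -
    have "(t + real n + 1) - (t + real n) \<le> len F (?B n)"
      using assms(3)[OF that]
      by (intro len_ge_snd assms(1,2)) (fastforce simp: lacks_def borel_Times)+
    then show ?thesis by simp
  qed
  then have "(\<Sum>n<T. 1) \<le> (\<Sum>n<T. len F (?B n))" by (intro sum_mono) auto
  also have "\<dots> \<le> len F ({a<..b} \<times> {t<..t + real T})"
  proof (rule len_superadditive)
    have "?B m \<inter> ?B n = {}" if "m < n" for m n
    proof -
      have "real m + 1 \<le> real n" using that by linarith
      then show ?thesis by auto
    qed
    then show "disjoint_family_on ?B {..<T}"
      unfolding disjoint_family_on_def by (metis inf_commute linorder_neqE_nat)
    show "?B n \<subseteq> {a<..b} \<times> {t<..t + real T}" if "n \<in> {..<T}" for n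
    proof -
      have "real n + 1 \<le> real T" using that by auto
      then show ?thesis by auto
    qed
  qed (auto simp: borel_Times)
  finally show ?thesis by simp
qed

text \<open>The new segments lie above the slot, so the path to the requested point enters
  \<open>{a<..b}\<close> horizontally from the left.\<close>

lemma len_ge_lacks:
  assumes A: "online_algorithm A" and inp: "rsa_input (ps @ [(b, t)])" and t: "last_y ps = t"
    and lacks: "lacks a b (drawn A ps) (t - 1)" and ab: "0 \<le> a" and t1: "1 \<le> t"
  shows "b - a \<le> len (drawn A (ps @ [(b, t)])) ({a<..b} \<times> {t - 1<..t})"
proof -
  let ?F = "drawn A (ps @ [(b, t)])"
  have conn: "connects ?F (b, t)" using feasible_drawn[OF A inp] by (simp add: feasible_def)
  obtain g where "monotone_path g \<and> g 0 = (0, 0) \<and> g 1 = (b, t) \<and>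
    (\<forall>s\<in>{0..1}. g s \<in> region ?F \<union> {(0, 0)}) \<and>
    (\<forall>s\<in>{0..1}. \<forall>z. fst (g s) \<le> z \<and> z \<le> fst (b, t) \<longrightarrow> (\<exists>r\<in>{s..1}. fst (g r) = z)) \<and>
    (\<forall>s\<in>{0..1}. \<forall>z. snd (g s) \<le> z \<and> z \<le> snd (b, t) \<longrightarrow> (\<exists>r\<in>{s..1}. snd (g r) = z))"
    using connects_path[OF conn] ..
  note g = conjunct1[OF this] this[THEN conjunct2, THEN conjunct1]
    this[THEN conjunct2, THEN conjunct2, THEN conjunct1]
    this[THEN conjunct2, THEN conjunct2, THEN conjunct2, THEN conjunct1, rule_format]
    this[THEN conjunct2, THEN conjunct2, THEN conjunct2, THEN conjunct2, THEN conjunct1, rule_format]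
    this[THEN conjunct2, THEN conjunct2, THEN conjunct2, THEN conjunct2, THEN conjunct2, rule_format]
  obtain v where v: "t - 1 < v" "v < t" "\<And>z. z \<in> {a<..b} \<Longrightarrow> (z, v) \<notin> region (drawn A ps)"
    using lacks unfolding lacks_def by auto
  have "\<exists>r\<in>{0..1}. snd (g r) = v" using g(2) v t1 by (intro g(6)) auto
  then obtain r where r: "r \<in> {0..1}" "snd (g r) = v" by blast
  have "g r \<in> region ?F" using g(4)[OF r(1)] r(2) v t1 by auto
  moreover have "g r \<notin> region (A (ps @ [(b, t)]))"
  proof
    assume "g r \<in> region (A (ps @ [(b, t)]))"
    then have "g r \<in> {z. prev_y (ps @ [(b, t)]) \<le> snd z}"
      using A inp unfolding online_algorithm_def region_def by blast
    then show False using r v t by (simp add: prev_y_snoc)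
  qed
  ultimately have "(fst (g r), v) \<in> region (drawn A ps)"
    using r(2) by (metis UN_Un Un_iff drawn_snoc prod.collapse region_def)
  moreover have "fst (g r) \<le> b" using monotone_pathD(1)[OF g(1), of r 1] r g(3) by simp
  ultimately have fr: "fst (g r) \<le> a" using v(3)[of "fst (g r)"] by fastforce
  show ?thesis
  proof (rule len_ge_fst)
    fix z assume z: "a < z" "z < b"
    have "\<exists>q\<in>{r..1}. fst (g q) = z" using r z fr by (intro g(5)) auto
    then obtain q where q: "q \<in> {r..1}" "fst (g q) = z" by blast
    have "v \<le> snd (g q)" using monotone_pathD(2)[OF g(1), of r q] q r by simp
    moreover have "snd (g q) \<le> t" using monotone_pathD(2)[OF g(1), of q 1] q r g(3) by simp
    moreover have "g q \<in> region ?F" using g(4)[of q] q r z ab by auto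
    ultimately show "\<exists>v. (z, v) \<in> region ?F \<inter> {a<..b} \<times> {t - 1<..t}"
      using q(2) z v(1) by (intro exI[of _ "snd (g q)"]) auto
  qed (use online_drawn[OF A inp] in \<open>auto simp: borel_Times\<close>)
qed

section \<open>Rounds of the adversary and their gain\<close>

lemma len_split:
  assumes "x \<le> a" "a \<le> y" "t \<le> t1" "t1 \<le> t2"
  shows "len F ({x<..} \<times> {t<..t1}) + len F ({a<..y} \<times> {t1<..t2}) + len F ({y<..} \<times> {t1<..t2})
    \<le> len F ({x<..} \<times> {t<..t2::real})"
proof -
  let ?B = "\<lambda>i::nat. if i = 0 then {x<..} \<times> {t<..t1} else
    if i = 1 then {a<..y} \<times> {t1<..t2} else {y<..} \<times> {t1<..t2}"
  have "(\<Sum>i\<in>{0,1,2}. len F (?B i)) \<le> len F ({x<..} \<times> {t<..t2})"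
    using assms
    by (intro len_superadditive) (auto simp: borel_Times disjoint_family_on_def)
  then show ?thesis by simp
qed

text \<open>The adversary is at \<open>(x, t)\<close> and \<open>S\<close> is the offline solution so far.\<close>

definition state :: "point list \<Rightarrow> real \<Rightarrow> real \<Rightarrow> segment set \<Rightarrow> bool" where
  "state ps x t S \<longleftrightarrow> rsa_input ps \<and> last_y ps = t \<and> 0 \<le> x \<and> feasible S (set ps) \<and> connects S (x, t)"

text \<open>\<open>\<kappa>\<close> is the ratio to be forced. Length counts only right of
  \<open>x\<close> and within the round, so consecutive rounds refer to disjoint regions.\<close>

definition gain :: "algorithm \<Rightarrow> real \<Rightarrow> point list \<Rightarrow> real \<Rightarrow> real \<Rightarrow> segment set \<Rightarrow>
    point list \<Rightarrow> nat \<Rightarrow> segment set \<Rightarrow> real" where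
  "gain A \<kappa> ps x t S qs T S' =
     len (drawn A (ps @ qs)) ({x<..} \<times> {t<..t + real T}) - \<kappa> * (cost S' - cost S)"

text \<open>A round of the adversary extends the input \<open>ps\<close> by \<open>qs\<close> and lasts \<open>T\<close> time units.
  It is aborted at the end of the first slot \<open>s\<close> at which an enclosing round wants to punish the
  algorithm for its solution \<open>D\<close>; this is what \<open>W D s\<close> expresses.\<close>

definition completed where
  "completed A W \<kappa> ps x t S L b qs T S' y \<longleftrightarrow>
     state (ps @ qs) y (t + real T) S' \<and> S \<subseteq> S' \<and> real T \<le> L \<and> length qs \<le> 2 * T \<and>
     x \<le> y \<and> y \<le> x + real T \<and> (\<forall>n<T. \<not> W (drawn A (ps @ qs)) (t + real n)) \<and>
     b (real T) (y - x) \<le> gain A \<kappa> ps x t S qs T S'"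

text \<open>The strict bound on \<open>length qs\<close> and the condition on the points of the
  final time leave room for one more request, at location \<open>x\<close>: the punishment.\<close>

definition aborted where
  "aborted A W \<kappa> ps x t S L b qs T S' \<longleftrightarrow>
     rsa_input (ps @ qs) \<and> last_y (ps @ qs) = t + real T \<and> feasible S' (set (ps @ qs)) \<and>
     S \<subseteq> S' \<and> real T \<le> L \<and> length qs < 2 * T \<and>
     (\<forall>p\<in>set (ps @ qs). snd p = t + real T \<longrightarrow> x < fst p) \<and>
     W (drawn A (ps @ qs)) (t + real T - 1) \<and>
     (\<forall>n. n + 1 < T \<longrightarrow> \<not> W (drawn A (ps @ qs)) (t + real n)) \<and>
     b (real T) \<le> gain A \<kappa> ps x t S qs T S'"

text \<open>Drawing more never triggers a watch, so a slot once passed stays passed while the input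
  grows.\<close>

definition antitone_watch :: "(segment set \<Rightarrow> real \<Rightarrow> bool) \<Rightarrow> bool" where
  "antitone_watch W \<longleftrightarrow> (\<forall>D D' s. D \<subseteq> D' \<longrightarrow> W D' s \<longrightarrow> W D s)"

lemma feasible_insert:
  assumes "feasible S P" "finite T" "\<forall>s\<in>T. axis_parallel s" "S \<subseteq> T" "connects T p"
  shows "feasible T (insert p P)"
  using assms connects_mono unfolding feasible_def by blast

lemma axis_parallel_vertical: "s \<le> t \<Longrightarrow> axis_parallel ((x, s), (x, t))"
  and axis_parallel_horizontal: "x \<le> y \<Longrightarrow> axis_parallel ((x, t), (y, t))"
  by (simp_all add: axis_parallel_def)

text \<open>The offline solution goes up and then right. Earlier requests lie strictly below
  \<open>t + 1\<close>, so the last condition concerns only the new one.\<close>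

lemma base_step:
  assumes st: "state ps x t S"
  obtains S' where "state (ps @ [(x + 1, t + 1)]) (x + 1) (t + 1) S'" "S \<subseteq> S'" "cost S' \<le> cost S + 2"
    "\<forall>p\<in>set (ps @ [(x + 1, t + 1)]). snd p = t + 1 \<longrightarrow> x < fst p"
proof -
  let ?u = "((x, t), (x, t + 1))" and ?h = "((x, t + 1), (x + 1, t + 1))"
  let ?S = "insert ?h (insert ?u S)"
  have fin: "finite S" "\<forall>s\<in>S. axis_parallel s" and conn: "connects S (x, t)"
    and inp: "rsa_input ps" "last_y ps = t" "0 \<le> x" and feas: "feasible S (set ps)"
    using st unfolding state_def feasible_def by auto
  have "connects (insert ?u S) (x, t + 1)" by (rule connects_up[OF conn, of _ t "t + 1"]) auto
  then have c: "connects ?S (x + 1, t + 1)"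
    by (rule connects_right[where a = x and b = "x + 1"]) auto
  have new: "snd p \<noteq> t + 1" if "p \<in> set ps" for p
    using rsa_input_le_last_y[OF inp(1) that] inp(2) by simp
  have "rsa_input (ps @ [(x + 1, t + 1)])" using inp new by (intro rsa_input_snoc) fastforce+
  moreover have "feasible ?S (insert (x + 1, t + 1) (set ps))"
    using fin by (intro feasible_insert[OF feas _ _ _ c])
      (auto simp: axis_parallel_vertical axis_parallel_horizontal)
  ultimately have "state (ps @ [(x + 1, t + 1)]) (x + 1) (t + 1) ?S"
    using inp c by (auto simp: state_def)
  moreover have "cost ?S \<le> cost S + 2"
    using cost_insert[of "insert ?u S" ?h] cost_insert[of S ?u] fin(1)
    by (simp add: dist_prod_def dist_real_def)
  ultimately show ?thesis using new by (intro that[of ?S]) auto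
qed

lemma antitone_watch_drawn:
  "antitone_watch W \<Longrightarrow> \<not> W (drawn A ps) s \<Longrightarrow> \<not> W (drawn A (ps @ qs)) s"
  using drawn_mono[of A ps qs] unfolding antitone_watch_def by blast

text \<open>The strip of width \<open>w\<close> left of \<open>y\<close> during the second run is
  counted by neither of the two gains; \<open>w \<le> y - x\<close> keeps it right of
  \<open>x\<close>, so its length \<open>e\<close> comes on top.\<close>

lemma gain_append:
  assumes A: "online_algorithm A" and inp: "rsa_input (ps @ qs @ qs')"
    and "0 \<le> \<kappa>" "x \<le> y"
    and extra: "e \<le> len (drawn A (ps @ qs @ qs')) ({y - w<..y} \<times> {t + real T<..t + real (T + T')})"
    and w: "0 \<le> w" "w \<le> y - x"
  shows "gain A \<kappa> ps x t S qs T S1 + gain A \<kappa> (ps @ qs) y (t + real T) S1 qs' T' S2 + e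
    \<le> gain A \<kappa> ps x t S (qs @ qs') (T + T') S2"
proof -
  let ?F = "drawn A (ps @ qs @ qs')"
  have "len (drawn A (ps @ qs)) ({x<..} \<times> {t<..t + real T}) \<le> len ?F ({x<..} \<times> {t<..t + real T})"
    using online_drawn(1)[OF A inp] drawn_mono[of A "ps @ qs" qs'] by (intro len_mono) auto
  moreover have "len ?F ({x<..} \<times> {t<..t + real T}) +
      len ?F ({y - w<..y} \<times> {t + real T<..t + real (T + T')}) +
      len ?F ({y<..} \<times> {t + real T<..t + real (T + T')})
    \<le> len ?F ({x<..} \<times> {t<..t + real (T + T')})"
    using w by (intro len_split) auto
  ultimately show ?thesis using extra
    unfolding gain_def by (simp add: algebra_simps)
qed

text \<open>The copy that the offline solution keeps at \<open>y\<close> during the aborted run costs at most \<open>L\<close>,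
  while reaching \<open>(y, t + T)\<close> costs the algorithm \<open>w\<close>.\<close>

lemma punish:
  assumes A: "online_algorithm A" and \<kappa>: "0 \<le> \<kappa>"
    and ab: "aborted A W' \<kappa> ps y t S L b qs T S1" and st: "state ps y t S"
    and lk: "lacks (y - w) y (drawn A (ps @ qs)) (t + real T - 1)" and w: "0 \<le> w" "w \<le> y"
  obtains S2 where "state (ps @ qs @ [(y, t + real T)]) y (t + real T) S2" "S \<subseteq> S2"
    "b (real T) - \<kappa> * L \<le> gain A \<kappa> ps y t S (qs @ [(y, t + real T)]) T S2"
    "w \<le> len (drawn A (ps @ qs @ [(y, t + real T)])) ({y - w<..y} \<times> {t<..t + real T})"
proof -
  let ?p = "(y, t + real T)" and ?u = "((y, t), (y, t + real T))"
  let ?S = "insert ?u S1"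
  have inp: "rsa_input (ps @ qs)" "last_y (ps @ qs) = t + real T" and feas: "feasible S1 (set (ps @ qs))"
    and sub: "S \<subseteq> S1" and TL: "real T \<le> L" and len: "length qs < 2 * T"
    and new: "\<forall>p\<in>set (ps @ qs). snd p = t + real T \<longrightarrow> y < fst p"
    and bg: "b (real T) \<le> gain A \<kappa> ps y t S qs T S1"
    using ab unfolding aborted_def by auto
  have T: "1 \<le> real T" using len by (cases T) auto
  have conn: "connects S (y, t)" and y: "0 \<le> y" and t0: "0 \<le> t"
    using st last_y_nonneg unfolding state_def by auto
  have c: "connects ?S ?p" by (rule connects_up[OF conn, of _ t "t + real T"]) (use sub in auto)
  have inp': "rsa_input (ps @ qs @ [?p])"
    using rsa_input_snoc[OF inp(1), of ?p] bspec[OF new, of ?p] inp(2) y by fastforce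
  have "feasible ?S (insert ?p (set (ps @ qs)))"
    using feas by (intro feasible_insert[OF feas _ _ _ c]) (auto simp: feasible_def axis_parallel_vertical)
  then have "state (ps @ qs @ [?p]) y (t + real T) ?S"
    using inp' c y by (auto simp: state_def last_y_def)
  moreover have "b (real T) - \<kappa> * L \<le> gain A \<kappa> ps y t S (qs @ [?p]) T ?S"
  proof -
    have "cost ?S \<le> cost S1 + real T"
      using cost_insert[of S1 ?u] feas by (simp add: feasible_def dist_prod_def dist_real_def)
    then have "\<kappa> * cost ?S \<le> \<kappa> * (cost S1 + L)" using TL \<kappa> by (intro mult_left_mono) auto
    moreover have "len (drawn A (ps @ qs)) ({y<..} \<times> {t<..t + real T})
        \<le> len (drawn A (ps @ qs @ [?p])) ({y<..} \<times> {t<..t + real T})"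
      using online_drawn(1)[OF A inp'] drawn_mono[of A "ps @ qs" "[?p]"] by (intro len_mono) auto
    ultimately show ?thesis using bg unfolding gain_def by (simp add: algebra_simps)
  qed
  moreover have "w \<le> len (drawn A (ps @ qs @ [?p])) ({y - w<..y} \<times> {t<..t + real T})"
  proof -
    have "y - (y - w) \<le> len (drawn A ((ps @ qs) @ [?p])) ({y - w<..y} \<times> {t + real T - 1<..t + real T})"
      using lk inp inp' w T t0 by (intro len_ge_lacks[OF A]) auto
    also have "\<dots> \<le> len (drawn A ((ps @ qs) @ [?p])) ({y - w<..y} \<times> {t<..t + real T})"
      using T by (intro len_subset) (auto simp: borel_Times)
    finally show ?thesis by simp
  qed
  ultimately show ?thesis using sub by (intro that[of ?S]) auto
qed

text \<open>Here \<open>T\<close> is the duration and \<open>X\<close> the progress. The terms are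
  the cost forced by levels up to \<open>k\<close>, the weighted cost of the offline steps, and a
  credit for missing progress, of which each higher level spends one share
  \<open>L - X\<close>.\<close>

definition complete_bound :: "real \<Rightarrow> real \<Rightarrow> real \<Rightarrow> real \<Rightarrow> real \<Rightarrow> real \<Rightarrow> real" where
  "complete_bound \<kappa> l k L T X = k / 2 * T - 2 * \<kappa> * T + (l + 1 - k) * (L - X)"

definition abort_bound :: "real \<Rightarrow> real \<Rightarrow> real \<Rightarrow> real \<Rightarrow> real" where
  "abort_bound \<kappa> k L T = k / 2 * T - 2 * \<kappa> * T - L"

text \<open>The invariant after \<open>n\<close> of the \<open>d\<close> subrounds of a round of level \<open>k + 1\<close>. A subround is
  watched once the position exceeds the start by \<open>(2 * l + 2) * L\<close>, so all but \<open>2 * l + 3\<close>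
  subrounds earn \<open>L\<close>, be it by a copy kept, by a punishment, or by a loss of progress.\<close>

definition children_bound :: "real \<Rightarrow> real \<Rightarrow> real \<Rightarrow> real \<Rightarrow> nat \<Rightarrow> real \<Rightarrow> real \<Rightarrow> real" where
  "children_bound \<kappa> l k L n T X = k / 2 * T - 2 * \<kappa> * T + (l - k) * (real n * L - X)
     + real n * L - min X ((2 * l + 3) * L)"

text \<open>All watches are allowed because a round is played inside arbitrary enclosing
  rounds.\<close>

definition play_outcome where
  "play_outcome A \<kappa> l k L \<longleftrightarrow> (\<forall>ps x t S W. state ps x t S \<longrightarrow> antitone_watch W \<longrightarrow>
     (\<exists>qs T S' y. completed A W \<kappa> ps x t S L (complete_bound \<kappa> l k L) qs T S' y) \<or>
     (\<exists>qs T S'. aborted A W \<kappa> ps x t S L (abort_bound \<kappa> k L) qs T S'))"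

text \<open>One more subround has three outcomes: it completes; an enclosing watch aborts it, which
  aborts the whole round; or only the watch on the strip fires, and the round goes on after a
  punishment.\<close>

lemma children_step:
  assumes A: "online_algorithm A" and \<kappa>: "0 \<le> \<kappa>" "\<kappa> \<le> l" and k: "0 \<le> k" "k + 1 \<le> l" and L: "0 < L"
    and d: "real d = 8 * l + 8"
    and play: "play_outcome A \<kappa> l k L" and W: "antitone_watch W" and n: "n < d"
    and comp: "completed A W \<kappa> ps x t S (real n * L) (children_bound \<kappa> l k L n) qs T S' y"
    and start: "state ps x t S"
  shows "(\<exists>qs T S' y. completed A W \<kappa> ps x t S (real (Suc n) * L) (children_bound \<kappa> l k L (Suc n)) qs T S' y)
    \<or> (\<exists>qs T S'. aborted A W \<kappa> ps x t S (real d * L) (abort_bound \<kappa> (k + 1) (real d * L)) qs T S')"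
proof -
  have st: "state (ps @ qs) y (t + real T) S'" and sub: "S \<subseteq> S'" and TL: "real T \<le> real n * L"
    and len: "length qs \<le> 2 * T" and xy: "x \<le> y" "y \<le> x + real T"
    and nW: "\<And>n. n < T \<Longrightarrow> \<not> W (drawn A (ps @ qs)) (t + real n)"
    and bd: "children_bound \<kappa> l k L n (real T) (y - x) \<le> gain A \<kappa> ps x t S qs T S'"
    using comp unfolding completed_def by blast+
  have x0: "0 \<le> x" using start by (simp add: state_def)
  define w where "w = (if y - x \<ge> (2 * l + 2) * L then (2 * l + 2) * L else 0)"
  have l: "0 \<le> l" using k by simp
  have w: "0 \<le> w" "w \<le> y - x" using xy L l by (auto simp: w_def)
  define W' where "W' = (\<lambda>D s. W D s \<or> w > 0 \<and> lacks (y - w) y D s)"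
  have W': "antitone_watch W'"
    using W lacks_antimono unfolding antitone_watch_def W'_def by blast
  have nW1: "\<not> W (drawn A (ps @ qs @ qs')) (t + real m)" if "m < T" for qs' m
    using antitone_watch_drawn[OF W nW[OF that], of qs'] by simp
  consider (C) qs1 T1 S1 y1 where
      "completed A W' \<kappa> (ps @ qs) y (t + real T) S' L (complete_bound \<kappa> l k L) qs1 T1 S1 y1"
    | (B) qs1 T1 S1 where
      "aborted A W' \<kappa> (ps @ qs) y (t + real T) S' L (abort_bound \<kappa> k L) qs1 T1 S1"
    using play st W' unfolding play_outcome_def by blast
  then show ?thesis
  proof cases
    case C
    have st1: "state (ps @ qs @ qs1) y1 (t + real (T + T1)) S1" and sub1: "S' \<subseteq> S1" and TL1: "real T1 \<le> L"
      and len1: "length qs1 \<le> 2 * T1" and xy1: "y \<le> y1" "y1 \<le> y + real T1"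
      and nW': "\<And>n. n < T1 \<Longrightarrow> \<not> W' (drawn A (ps @ qs @ qs1)) (t + real T + real n)"
      and bd1: "complete_bound \<kappa> l k L (real T1) (y1 - y) \<le> gain A \<kappa> (ps @ qs) y (t + real T) S' qs1 T1 S1"
      using C unfolding completed_def by (auto simp: add.assoc)
    have inp1: "rsa_input (ps @ qs @ qs1)" using st1 by (simp add: state_def)
    \<comment> \<open>A completed subround passes every slot unaborted, so while the strip is
      watched the algorithm keeps a copy there in all \<open>T1\<close> slots.\<close>
    define e where "e = (if w > 0 then real T1 else 0)"
    have "e \<le> len (drawn A (ps @ qs @ qs1)) ({y - w<..y} \<times> {t + real T<..t + real (T + T1)})"
    proof (cases "w > 0")
      case True
      then have "real T1 \<le> len (drawn A (ps @ qs @ qs1)) ({y - w<..y} \<times> {t + real T<..t + real T + real T1})"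
        using nW' online_drawn[OF A inp1] by (intro len_ge_not_lacks) (auto simp: W'_def)
      then show ?thesis using True by (simp add: e_def add.assoc)
    qed (simp add: e_def len_nonneg)
    then have "gain A \<kappa> ps x t S qs T S' + gain A \<kappa> (ps @ qs) y (t + real T) S' qs1 T1 S1 + e
        \<le> gain A \<kappa> ps x t S (qs @ qs1) (T + T1) S1"
      using w xy by (intro gain_append[OF A inp1 \<kappa>(1) xy(1)]) auto
    moreover have "children_bound \<kappa> l k L (Suc n) (real (T + T1)) (y1 - x) \<le>
        children_bound \<kappa> l k L n (real T) (y - x) + complete_bound \<kappa> l k L (real T1) (y1 - y) + e"
    proof -
      \<comment> \<open>If the strip is watched, \<open>e = T1\<close> pays for the progress
        \<open>y1 - y\<close>. Otherwise \<open>y1 - x \<le> (2 * l + 3) * L\<close> still holds,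
        and the minimum grows by the whole progress.\<close>
      have "L + min (y - x) ((2 * l + 3) * L) \<le> L - (y1 - y) + e + min (y1 - x) ((2 * l + 3) * L)"
      proof (cases "(2 * l + 2) * L \<le> y - x")
        case True
        then have "e = real T1" using L l by (auto simp: e_def w_def)
        moreover have "min (y - x) ((2 * l + 3) * L) \<le> min (y1 - x) ((2 * l + 3) * L)"
          using xy1 by (intro min.mono) auto
        ultimately show ?thesis using xy1 by simp
      next
        case False
        have "(2 * l + 3) * L = (2 * l + 2) * L + L" by (simp add: algebra_simps)
        then have "y1 - x \<le> (2 * l + 3) * L" using False xy1 TL1 by simp
        moreover have "0 \<le> e" by (simp add: e_def)
        ultimately show ?thesis using xy1 by (simp add: min_def)
      qed
      then show ?thesis
        unfolding children_bound_def complete_bound_def by (simp add: algebra_simps add_divide_distrib)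
    qed
    ultimately have "children_bound \<kappa> l k L (Suc n) (real (T + T1)) (y1 - x)
        \<le> gain A \<kappa> ps x t S (qs @ qs1) (T + T1) S1"
      using bd bd1 by linarith
    moreover have "\<not> W (drawn A (ps @ qs @ qs1)) (t + real m)" if "m < T + T1" for m
    proof (cases "m < T")
      case False
      then show ?thesis using nW'[of "m - T"] that by (auto simp: W'_def of_nat_diff)
    qed (rule nW1)
    moreover have "real (T + T1) \<le> real (Suc n) * L" using TL TL1 by (simp add: algebra_simps)
    ultimately have "completed A W \<kappa> ps x t S (real (Suc n) * L) (children_bound \<kappa> l k L (Suc n))
        (qs @ qs1) (T + T1) S1 y1"
      using st1 sub sub1 len len1 xy xy1 unfolding completed_def by auto
    then show ?thesis by blast
  next
    case B
    have inp1: "rsa_input (ps @ qs @ qs1)" and ly1: "last_y (ps @ qs @ qs1) = t + real (T + T1)"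
      and feas1: "feasible S1 (set (ps @ qs @ qs1))"
      and sub1: "S' \<subseteq> S1" and TL1: "real T1 \<le> L" and len1: "length qs1 < 2 * T1"
      and new1: "\<forall>p\<in>set (ps @ qs @ qs1). snd p = t + real (T + T1) \<longrightarrow> y < fst p"
      and WW: "W' (drawn A (ps @ qs @ qs1)) (t + real (T + T1) - 1)"
      and nW': "\<And>n. n + 1 < T1 \<Longrightarrow> \<not> W' (drawn A (ps @ qs @ qs1)) (t + real T + real n)"
      and bd1: "abort_bound \<kappa> k L (real T1) \<le> gain A \<kappa> (ps @ qs) y (t + real T) S' qs1 T1 S1"
      using B unfolding aborted_def by (auto simp: add.assoc)
    have nW2: "\<not> W (drawn A (ps @ qs @ qs1)) (t + real m)" if "m + 1 < T + T1" for m
    proof (cases "m < T")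
      case False
      then show ?thesis using nW'[of "m - T"] that by (auto simp: W'_def of_nat_diff)
    qed (rule nW1)
    have TT: "real (T + T1) \<le> real (Suc n) * L" using TL TL1 by (simp add: algebra_simps)
    show ?thesis
    proof (cases "W (drawn A (ps @ qs @ qs1)) (t + real (T + T1) - 1)")
      case True
      have "gain A \<kappa> ps x t S qs T S' + gain A \<kappa> (ps @ qs) y (t + real T) S' qs1 T1 S1 + 0
          \<le> gain A \<kappa> ps x t S (qs @ qs1) (T + T1) S1"
        using w xy by (intro gain_append[OF A inp1 \<kappa>(1) xy(1), where w = 0]) (auto simp: len_nonneg)
      \<comment> \<open>The forfeited \<open>d * L\<close> covers both the additional
        \<open>(T + T1) / 2\<close> and the \<open>L\<close> forfeited by the subround, each at most
        half of it.\<close>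
      moreover have "abort_bound \<kappa> (k + 1) (real d * L) (real (T + T1)) \<le>
          children_bound \<kappa> l k L n (real T) (y - x) + abort_bound \<kappa> k L (real T1)"
      proof -
        have "real (Suc n) * L \<le> real d * L" using n L by (intro mult_right_mono) auto
        then have "real (T + T1) \<le> real d * L" using TT by simp
        moreover have "2 * L \<le> real d * L" using d l L by (intro mult_right_mono) auto
        moreover have "0 \<le> (l - k) * (real n * L - (y - x))"
          using k xy TL by (intro mult_nonneg_nonneg) auto
        moreover have "min (y - x) ((2 * l + 3) * L) \<le> real n * L" using xy TL by auto
        ultimately show ?thesis
          unfolding children_bound_def abort_bound_def by (simp add: algebra_simps add_divide_distrib)
      qed
      ultimately have "abort_bound \<kappa> (k + 1) (real d * L) (real (T + T1))
          \<le> gain A \<kappa> ps x t S (qs @ qs1) (T + T1) S1"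
        using bd bd1 by linarith
      moreover have "real (T + T1) \<le> real d * L"
        using order_trans[OF TT mult_right_mono[of "real (Suc n)" "real d" L]] n L by simp
      ultimately have "aborted A W \<kappa> ps x t S (real d * L) (abort_bound \<kappa> (k + 1) (real d * L))
          (qs @ qs1) (T + T1) S1"
        using inp1 ly1 feas1 sub sub1 len len1 new1 True nW2 xy unfolding aborted_def by force
      then show ?thesis by blast
    next
      case False
      then have lk: "w > 0" "lacks (y - w) y (drawn A (ps @ qs @ qs1)) (t + real (T + T1) - 1)"
        using WW by (auto simp: W'_def)
      have weq: "w = (2 * l + 2) * L" using lk(1) by (auto simp: w_def split: if_splits)
      define p where "p = (y, t + real T + real T1)"
      obtain S2 where S2: "state ((ps @ qs) @ qs1 @ [p]) y (t + real T + real T1) S2" "S' \<subseteq> S2"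
        "abort_bound \<kappa> k L (real T1) - \<kappa> * L \<le> gain A \<kappa> (ps @ qs) y (t + real T) S' (qs1 @ [p]) T1 S2"
        "w \<le> len (drawn A ((ps @ qs) @ qs1 @ [p])) ({y - w<..y} \<times> {t + real T<..t + real T + real T1})"
        using punish[OF A \<kappa>(1) B st, of w] lk w x0 unfolding p_def
        by (auto simp: add.assoc)
      have inp2: "rsa_input (ps @ qs @ qs1 @ [p])" using S2(1) by (simp add: state_def)
      have "gain A \<kappa> ps x t S qs T S' + gain A \<kappa> (ps @ qs) y (t + real T) S' (qs1 @ [p]) T1 S2 + w
          \<le> gain A \<kappa> ps x t S (qs @ qs1 @ [p]) (T + T1) S2"
        using w S2(4) by (intro gain_append[OF A _ \<kappa>(1) xy(1)]) (auto simp: inp2 add.assoc)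
      moreover have "children_bound \<kappa> l k L (Suc n) (real (T + T1)) (y - x) \<le>
          children_bound \<kappa> l k L n (real T) (y - x) + (abort_bound \<kappa> k L (real T1) - \<kappa> * L) + w"
      proof -
        \<comment> \<open>The forced delivery pays \<open>(l - k) * L + L\<close> for raising
          \<open>n\<close>, the \<open>L\<close> missing in \<open>abort_bound\<close>, and
          \<open>\<kappa> * L\<close> for the offline copy. This determines the strip width
          \<open>(2 * l + 2) * L\<close>.\<close>
        have "(l - k) * L + L + L + \<kappa> * L \<le> w"
        proof -
          have "(l - k + 2 + \<kappa>) * L \<le> (2 * l + 2) * L" using \<kappa> k L by (intro mult_right_mono) auto
          then show ?thesis by (simp add: weq algebra_simps)
        qed
        then show ?thesis
          unfolding children_bound_def abort_bound_def by (simp add: algebra_simps add_divide_distrib)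
      qed
      ultimately have "children_bound \<kappa> l k L (Suc n) (real (T + T1)) (y - x)
          \<le> gain A \<kappa> ps x t S (qs @ qs1 @ [p]) (T + T1) S2"
        using bd S2(3) by linarith
      moreover have "\<not> W (drawn A (ps @ qs @ qs1 @ [p])) (t + real m)" if "m < T + T1" for m
      proof -
        have "\<not> W (drawn A (ps @ qs @ qs1)) (t + real m)"
        proof (cases "m + 1 < T + T1")
          case False
          then have "t + real m = t + real (T + T1) - 1" using that by linarith
          then show ?thesis using \<open>\<not> W (drawn A (ps @ qs @ qs1)) (t + real (T + T1) - 1)\<close> by (simp only: not_False_eq_True)
        qed (rule nW2)
        from antitone_watch_drawn[OF W this, of "[p]"] show ?thesis by simp
      qed
      ultimately have "completed A W \<kappa> ps x t S (real (Suc n) * L) (children_bound \<kappa> l k L (Suc n))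
          (qs @ qs1 @ [p]) (T + T1) S2 y"
        using S2(1,2) sub len len1 xy TT unfolding completed_def by (auto simp: add.assoc)
      then show ?thesis by blast
    qed
  qed
qed

lemma play_outcome_Suc:
  assumes A: "online_algorithm A" and \<kappa>: "0 \<le> \<kappa>" "\<kappa> \<le> l" and k: "0 \<le> k" "k + 1 \<le> l" and L: "0 < L"
    and d: "real d = 8 * l + 8" and play: "play_outcome A \<kappa> l k L"
  shows "play_outcome A \<kappa> l (k + 1) (real d * L)"
  unfolding play_outcome_def
proof (intro allI impI)
  fix ps x t S W assume st: "state ps x t S" and W: "antitone_watch W"
  have "(\<exists>qs T S' y. completed A W \<kappa> ps x t S (real n * L) (children_bound \<kappa> l k L n) qs T S' y)
      \<or> (\<exists>qs T S'. aborted A W \<kappa> ps x t S (real d * L) (abort_bound \<kappa> (k + 1) (real d * L)) qs T S')"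
    if "n \<le> d" for n
    using that
  proof (induction n)
    case 0
    have "completed A W \<kappa> ps x t S (real 0 * L) (children_bound \<kappa> l k L 0) [] 0 S x"
      using st L k by (auto simp: completed_def children_bound_def gain_def len_nonneg)
    then show ?case by blast
  next
    case (Suc n)
    then show ?case
      using children_step[OF A \<kappa> k L d play W _ _ st] by (auto simp: Suc_le_eq)
  qed
  from this[of d] consider
      qs T S' y where "completed A W \<kappa> ps x t S (real d * L) (children_bound \<kappa> l k L d) qs T S' y"
    | "\<exists>qs T S'. aborted A W \<kappa> ps x t S (real d * L) (abort_bound \<kappa> (k + 1) (real d * L)) qs T S'"
    by blast
  then show "(\<exists>qs T S' y. completed A W \<kappa> ps x t S (real d * L)
        (complete_bound \<kappa> l (k + 1) (real d * L)) qs T S' y)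
      \<or> (\<exists>qs T S'. aborted A W \<kappa> ps x t S (real d * L) (abort_bound \<kappa> (k + 1) (real d * L)) qs T S')"
  proof cases
    case (1 qs T S' y)
    have TL: "real T \<le> real d * L" using 1 by (simp add: completed_def)
    \<comment> \<open>The choice of \<open>d\<close> makes \<open>(2 * l + 3) * L\<close> at most
      half of \<open>d * L\<close>; the other half is at least the additional \<open>T / 2\<close>
      of the next level.\<close>
    have "(l + 1) * (2 * L) + L + real d * L / 2 \<le> real d * L"
      using k L by (simp add: d algebra_simps)
    moreover have "min (y - x) ((2 * l + 3) * L) \<le> (l + 1) * (2 * L) + L"
      by (rule min.coboundedI2) (simp add: algebra_simps)
    ultimately have "complete_bound \<kappa> l (k + 1) (real d * L) (real T) (y - x)
        \<le> children_bound \<kappa> l k L d (real T) (y - x)"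
      unfolding complete_bound_def children_bound_def using TL by (simp add: algebra_simps add_divide_distrib)
    then show ?thesis using 1 unfolding completed_def by (blast intro: order_trans)
  qed blast
qed

text \<open>Level \<open>0\<close> is a single step with full progress, so the credit is zero and
  the algorithm need not pay anything.\<close>

lemma play_outcome_0:
  assumes A: "online_algorithm A" and \<kappa>: "0 \<le> \<kappa>"
  shows "play_outcome A \<kappa> l 0 1"
  unfolding play_outcome_def
proof (intro allI impI)
  fix ps x t S W assume st: "state ps x t S" and W: "antitone_watch W"
  let ?p = "(x + 1, t + 1)"
  obtain S' where S': "state (ps @ [?p]) (x + 1) (t + 1) S'" "S \<subseteq> S'" "cost S' \<le> cost S + 2"
    "\<forall>p\<in>set (ps @ [?p]). snd p = t + 1 \<longrightarrow> x < fst p"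
    using base_step[OF st] .
  have "\<kappa> * cost S' \<le> \<kappa> * (cost S + 2)" using S'(3) \<kappa> by (intro mult_left_mono)
  then have g: "- 2 * \<kappa> \<le> gain A \<kappa> ps x t S [?p] 1 S'"
    using len_nonneg[of "drawn A (ps @ [?p])" "{x<..} \<times> {t<..t + 1}"]
    by (simp add: gain_def algebra_simps)
  show "(\<exists>qs T S' y. completed A W \<kappa> ps x t S 1 (complete_bound \<kappa> l 0 1) qs T S' y) \<or>
     (\<exists>qs T S'. aborted A W \<kappa> ps x t S 1 (abort_bound \<kappa> 0 1) qs T S')"
  proof (cases "W (drawn A (ps @ [?p])) t")
    case True
    then have "aborted A W \<kappa> ps x t S 1 (abort_bound \<kappa> 0 1) [?p] 1 S'"
      using S' g by (auto simp: aborted_def abort_bound_def state_def)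
    then show ?thesis by blast
  next
    case False
    then have "completed A W \<kappa> ps x t S 1 (complete_bound \<kappa> l 0 1) [?p] 1 S' (x + 1)"
      using S' g by (auto simp: completed_def complete_bound_def)
    then show ?thesis by blast
  qed
qed

lemma play_outcome:
  assumes "online_algorithm A" "0 \<le> \<kappa>" "\<kappa> \<le> real l" "k \<le> l"
  shows "play_outcome A \<kappa> (real l) (real k) (real ((8 * l + 8) ^ k))"
  using assms(4)
proof (induction k)
  case 0
  then show ?case using play_outcome_0[OF assms(1,2)] by simp
next
  case (Suc k)
  have "play_outcome A \<kappa> (real l) (real k + 1) (real (8 * l + 8) * real ((8 * l + 8) ^ k))"
    using Suc assms by (intro play_outcome_Suc) auto
  then show ?case by (simp add: algebra_simps)
qed

section \<open>The lower bound for every large number of requests\<close>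

lemma adversary:
  assumes A: "online_algorithm A" and l: "4 \<le> l"
  obtains ps S x where "state ps x (last_y ps) S" "length ps \<le> 2 * (8 * l + 8) ^ l"
    "real l / 8 * (cost S + 1) \<le> cost (drawn A ps)"
proof -
  let ?L = "(8 * l + 8) ^ l" and ?\<kappa> = "real l / 8"
  have "state [] 0 0 {}"
    by (simp add: state_def rsa_input_Nil last_y_def feasible_def connects_origin)
  moreover have "antitone_watch (\<lambda>D s. False)" by (simp add: antitone_watch_def)
  moreover have "play_outcome A ?\<kappa> (real l) (real l) (real ?L)" by (rule play_outcome[OF A]) auto
  \<comment> \<open>Nobody watches the outermost round, so it is not aborted.\<close>
  ultimately obtain ps T S y where
    "completed A (\<lambda>D s. False) ?\<kappa> [] 0 0 {} ?L (complete_bound ?\<kappa> l l ?L) ps T S y"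
    unfolding play_outcome_def aborted_def by blast
  then have st: "state ps y (real T) S" and T: "real T \<le> real ?L" and len: "length ps \<le> 2 * T"
    and y: "y \<le> real T" and b: "complete_bound ?\<kappa> l l ?L T y \<le> gain A ?\<kappa> [] 0 0 {} ps T S"
    unfolding completed_def by auto
  have Tn: "T \<le> ?L" using T by linarith
  have "real l * 1 \<le> real (8 * l + 8) ^ 1" by simp
  also have "\<dots> \<le> real (8 * l + 8) ^ l" using l by (intro power_increasing) auto
  finally have lL: "real l \<le> real ?L" by simp
  \<comment> \<open>With \<open>\<kappa> = l / 8\<close> and \<open>k = l\<close> the bound becomes
    the right-hand side. From \<open>4 \<le> l\<close> follows
    \<open>l / 4 * T \<ge> T \<ge> y\<close>, so at least \<open>?L \<ge> l\<close> remains, enough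
    for the \<open>+ 1\<close> that padding will use.\<close>
  have "real l / 8 \<le> real l / 4 * real T + (real ?L - y)"
  proof -
    have "1 * real T \<le> real l / 4 * real T" using l by (intro mult_right_mono) auto
    then show ?thesis using lL y by linarith
  qed
  also have "\<dots> = complete_bound ?\<kappa> l l ?L T y" by (simp add: complete_bound_def)
  also have "\<dots> \<le> len (drawn A ps) ({0<..} \<times> {0<..real T}) - ?\<kappa> * cost S"
    using b by (simp add: gain_def cost_def)
  finally have "?\<kappa> * (cost S + 1) \<le> len (drawn A ps) ({0<..} \<times> {0<..real T})" by (simp add: algebra_simps)
  also have "\<dots> \<le> len (drawn A ps) UNIV" by (intro len_subset) (auto simp: borel_Times)
  also have "\<dots> \<le> cost (drawn A ps)"
    using st online_drawn(2)[OF A] by (intro len_UNIV_le_cost) (auto simp: state_def)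
  finally have "?\<kappa> * (cost S + 1) \<le> cost (drawn A ps)" .
  moreover have "state ps y (last_y ps) S" using st by (simp add: state_def)
  ultimately show ?thesis using len Tn by (intro that[of ps y S]) auto
qed

text \<open>\<open>competitive_on\<close> fixes the exact number of requests, so the input is filled
  up with points on a vertical unit segment above \<open>(x, t)\<close>; they lie strictly above
  \<open>t\<close> and hence are new.\<close>

lemma pad_input:
  assumes st: "state ps x (last_y ps) S"
  obtains qs S' where "rsa_input (ps @ qs)" "length qs = m" "feasible S' (set (ps @ qs))"
    "cost S' \<le> cost S + 1"
proof -
  define t where "t = last_y ps"
  define qs where "qs = map (\<lambda>i. (x, t + (real i + 1) / (real m + 1))) [0..<m]"
  let ?u = "((x, t), (x, t + 1))"
  have inp: "rsa_input ps" and x: "0 \<le> x" and feas: "feasible S (set ps)" and conn: "connects S (x, t)"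
    using st by (auto simp: state_def t_def)
  have t: "0 \<le> t" using last_y_nonneg[OF inp] by (simp add: t_def)
  have qs: "fst p = x \<and> t < snd p \<and> snd p \<le> t + 1" if "p \<in> set qs" for p
    using that by (auto simp: qs_def)
  have "distinct qs" by (auto simp: qs_def distinct_map inj_on_def)
  moreover have "sorted (map snd qs)"
    by (auto simp: qs_def sorted_map o_def sorted_wrt_iff_nth_less divide_right_mono)
  ultimately have "rsa_input (ps @ qs)"
    using inp qs x t rsa_input_le_last_y[OF inp] unfolding rsa_input_def t_def[symmetric]
    by (fastforce simp: sorted_append)
  moreover have "feasible (insert ?u S) (set (ps @ qs))"
  proof -
    have "connects (insert ?u S) p" if "p \<in> set qs" for p
    proof -
      have "connects (insert ?u S) (x, snd p)"
        using qs[OF that] by (intro connects_up[OF conn, of _ t "t + 1"]) auto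
      then show ?thesis using qs[OF that] by (metis prod.collapse)
    qed
    moreover have "connects (insert ?u S) p" if "p \<in> set ps" for p
      using feas that connects_mono[of S p "insert ?u S"] by (auto simp: feasible_def)
    ultimately show ?thesis using feas by (auto simp: feasible_def axis_parallel_vertical)
  qed
  moreover have "cost (insert ?u S) \<le> cost S + 1"
    using cost_insert[of S ?u] feas by (simp add: feasible_def dist_prod_def dist_real_def)
  ultimately show ?thesis by (intro that[of qs "insert ?u S"]) (auto simp: qs_def)
qed

lemma competitive_ratio_ge:
  assumes A: "online_algorithm A" and comp: "competitive_on A N r" and l: "4 \<le> l"
    and N: "2 * (8 * l + 8) ^ l \<le> N"
  shows "real l / 8 \<le> r"
proof -
  obtain ps S x where 1: "state ps x (last_y ps) S" "length ps \<le> 2 * (8 * l + 8) ^ l"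
    "real l / 8 * (cost S + 1) \<le> cost (drawn A ps)"
    using adversary[OF A l] .
  obtain qs S' where 2: "rsa_input (ps @ qs)" "length qs = N - length ps"
    "feasible S' (set (ps @ qs))" "cost S' \<le> cost S + 1"
    using pad_input[OF 1(1)] .
  let ?o = "opt (set (ps @ qs))"
  have o: "?o \<le> cost S + 1" using opt_le_cost[OF 2(3)] 2(4) by simp
  have o0: "0 \<le> ?o" by (rule opt_greatest[OF 2(3) cost_nonneg])
  have "length (ps @ qs) = N" using 1(2) 2(2) N by simp
  then have "cost (drawn A (ps @ qs)) \<le> r * ?o" using comp 2(1) unfolding competitive_on_def by blast
  moreover have "cost (drawn A ps) \<le> cost (drawn A (ps @ qs))"
    using online_drawn(1)[OF A 2(1)] drawn_mono by (rule cost_mono)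
  ultimately have *: "real l / 8 * (cost S + 1) \<le> r * ?o" using 1(3) by simp
  \<comment> \<open>The ratio \<open>r\<close> is an arbitrary real; it is positive because the
    algorithm has positive cost, and only then may the optimum be replaced by its upper
    bound.\<close>
  have "0 < real l / 8 * (cost S + 1)" using l cost_nonneg[of S] by simp
  then have "0 < r * ?o" using * by simp
  then have "0 < ?o" "0 < r" using o0 by (auto simp: zero_less_mult_iff)
  have "real l / 8 * (cost S + 1) \<le> r * (cost S + 1)"
    using order_trans[OF * mult_left_mono[OF o]] \<open>0 < r\<close> by simp
  then show ?thesis using cost_nonneg[of S] by (simp add: mult_le_cancel_right)
qed

text \<open>With \<open>f\<close> the claimed function and \<open>l\<close> about
  \<open>f N / 2\<close>, \<open>8 * l + 8 \<le> 4 * f N + 8 \<le> ln N\<close>, so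
  \<open>l * ln (8 * l + 8) \<le> ln N / 2\<close> and the adversary needs at most \<open>N\<close>
  requests. Rounding costs at most a factor \<open>2\<close>, which gives
  \<open>1 / 32\<close>.\<close>

lemma lower_bound:
  "\<exists>c>0. \<forall>\<^sub>F N in sequentially. \<forall>A r. online_algorithm A \<and> competitive_on A N r \<longrightarrow>
     c * (ln (real N) / ln (ln (real N))) \<le> r"
proof -
  define f :: "real \<Rightarrow> real" where "f N = ln N / ln (ln N)" for N
  have "\<forall>\<^sub>F N in at_top. 10 \<le> f N" "\<forall>\<^sub>F N in at_top. 4 * f N + 8 \<le> ln N"
    "\<forall>\<^sub>F N::real in at_top. 4 \<le> ln N" "\<forall>\<^sub>F N::real in at_top. 0 < ln (ln N)"
    unfolding f_def by real_asymp+
  then have "\<forall>\<^sub>F N::real in at_top. 10 \<le> f N \<and> 4 * f N + 8 \<le> ln N \<and> 4 \<le> ln N \<and> 0 < ln (ln N)"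
    by (simp add: eventually_conj_iff)
  then have "\<forall>\<^sub>F N in sequentially. 10 \<le> f (real N) \<and> 4 * f (real N) + 8 \<le> ln (real N) \<and>
      4 \<le> ln (real N) \<and> 0 < ln (ln (real N))"
    by (rule eventually_compose_filterlim) (rule filterlim_real_sequentially)
  then have "\<forall>\<^sub>F N in sequentially. \<forall>A r. online_algorithm A \<and> competitive_on A N r \<longrightarrow>
     1 / 32 * f (real N) \<le> r"
  proof (rule eventually_mono, intro allI impI)
    fix N :: nat and A r
    assume f: "10 \<le> f (real N) \<and> 4 * f (real N) + 8 \<le> ln (real N) \<and>
      4 \<le> ln (real N) \<and> 0 < ln (ln (real N))" and A: "online_algorithm A \<and> competitive_on A N r"
    define l where "l = nat \<lfloor>f (real N) / 2\<rfloor>"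
    have l: "real l \<le> f (real N) / 2" "f (real N) / 2 - 1 \<le> real l" "4 \<le> l"
      using f unfolding l_def by linarith+
    have N: "0 < real N" using f by (cases "N = 0") auto
    have "ln (2 * real (8 * l + 8) ^ l) = ln 2 + real l * ln (real (8 * l + 8))"
      by (subst ln_mult) (auto simp: ln_realpow)
    also have "\<dots> \<le> 1 + f (real N) / 2 * ln (ln (real N))"
    proof (intro add_mono mult_mono)
      show "ln (2::real) \<le> 1" using ln_le_minus_one[of "2::real"] by simp
      show "ln (real (8 * l + 8)) \<le> ln (ln (real N))" using f l by (subst ln_le_cancel_iff) auto
    qed (use f l in auto)
    also have "\<dots> = 1 + ln (real N) / 2" using f by (simp add: f_def)
    also have "\<dots> \<le> ln (real N)" using f by simp
    finally have "2 * real (8 * l + 8) ^ l \<le> real N" using N by (subst (asm) ln_le_cancel_iff) auto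
    then have "2 * (8 * l + 8) ^ l \<le> N" by (metis (mono_tags) of_nat_le_iff of_nat_mult of_nat_numeral of_nat_power)
    then have "real l / 8 \<le> r" using A l by (intro competitive_ratio_ge[of A N]) auto
    moreover have "1 / 32 * f (real N) \<le> real l / 8" using l f by simp
    ultimately show "1 / 32 * f (real N) \<le> r" by simp
  qed
  then show ?thesis unfolding f_def by (intro exI[of _ "1/32"]) auto
qed

theorem theorem3:
  shows "(\<exists>A r. online_algorithm A \<and> (\<forall>N. competitive_on A N (r N)) \<and>
            r \<in> O(\<lambda>N. ln (real N) / ln (ln (real N)))) \<and>
         (\<exists>c>0. \<forall>\<^sub>F N in sequentially. \<forall>A r. online_algorithm A \<and> competitive_on A N r \<longrightarrow>
            c * (ln (real N) / ln (ln (real N))) \<le> r)"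
proof (rule conjI[OF _ lower_bound])
  show "\<exists>A r. online_algorithm A \<and> (\<forall>N. competitive_on A N (r N)) \<and>
      r \<in> O(\<lambda>N. ln (real N) / ln (ln (real N)))"
    by (intro exI[of _ alg] exI[of _ "\<lambda>N. 34 * 2 ^ Suc (phase_of N)"] conjI allI
        online_alg alg_competitive phase_of_asymptotics)
qed

end
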